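(* Let $d\ge 3$, let $\|\cdot\|$ be a fixed norm on $\mathbb{R}^d$, let $p\in[1,\frac d2)$ and $q>\frac{dp}{d-p}$. There exists a constant $\kappa_{p,q}^{\mathrm{Pierce}}$ (depending only on $p,q,d$ and the norm) such that for any probability measure $\mu$ on $\mathbb{R}^d$ $$V_{N,p}^{\mathrm{rand}}(\mu)\le \kappa_{p,q}^{\mathrm{Pierce}}\,\Bigl[\int_{\mathbb{R}^d}\|x\|^q\,\mathrm{d}\mu(x)\Bigr]^{1/q}\,N^{-1/d}$$ for all $N\in\mathbb{N}=\{1,2,\dots\}$.
   Context: All measures are on Borel sets. For finite measures $\mu,\nu$ on $\mathbb{R}^d$ of equal total mass, the $p$th Wasserstein metric with respect to the norm $\|\cdot\|$ is $$\rho_p(\mu,\nu)=\inf_{\xi\in\mathcal{M}(\mu,\nu)}\Bigl(\int_{\mathbb{R}^d\times\mathbb{R}^d}\|x-y\|^p\,\xi(\mathrm{d}x,\mathrm{d}y)\Bigr)^{1/p},$$ where $\mathcal{M}(\mu,\nu)$ is the set of finite measures on $\mathbb{R}^d\times\mathbb{R}^d$ with first marginal $\mu$ and second marginal $\nu$. For a probability measure $\mu$ on $\mathbb{R}^d$ and $N\in\mathbb{N}$, let $\hat\mu_N=\frac1N\sum_{j=1}^N\delta_{X_j}$ be the empirical measure of $N$ independent $\mu$-distributed random variables $X_1,\dots,X_N$, and define the random quantization error $V_{N,p}^{\mathrm{rand}}(\mu):=\mathbb{E}[\rho_p^p(\mu,\hat\mu_N)]^{1/p}$. *)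

theory Defs
  imports "HOL-Probability.Probability"
begin

text \<open>An arbitrary norm, which need not be the Euclidean norm of the type class.\<close>

definition is_norm :: "('a::real_vector \<Rightarrow> real) \<Rightarrow> bool" where
  "is_norm nrm \<longleftrightarrow>
     (\<forall>x. 0 \<le> nrm x) \<and>
     (\<forall>x. nrm x = 0 \<longleftrightarrow> x = 0) \<and>
     (\<forall>c x. nrm (c *\<^sub>R x) = \<bar>c\<bar> * nrm x) \<and>
     (\<forall>x y. nrm (x + y) \<le> nrm x + nrm y)"

text \<open>Real powers on \<open>[0, \<infinity>]\<close>, used only for exponents \<open>a > 0\<close>. Moments and transport costs
  are kept in \<^typ>\<open>ennreal\<close> because they may be infinite; Bochner integrals would be \<open>0\<close> then.\<close>

definition ennreal_powr :: "ennreal \<Rightarrow> real \<Rightarrow> ennreal" where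
  "ennreal_powr x a = (if x = \<infinity> then \<infinity> else ennreal (enn2real x powr a))"

definition couplings :: "'a::topological_space measure \<Rightarrow> 'a measure \<Rightarrow> ('a \<times> 'a) measure set" where
  "couplings \<mu> \<nu> =
     {\<xi>. sets \<xi> = sets borel \<and> finite_measure \<xi> \<and> distr \<xi> borel fst = \<mu> \<and> distr \<xi> borel snd = \<nu>}"

definition wasserstein ::
  "('a::real_normed_vector \<Rightarrow> real) \<Rightarrow> real \<Rightarrow> 'a measure \<Rightarrow> 'a measure \<Rightarrow> ennreal" where
  "wasserstein nrm p \<mu> \<nu> =
     (INF \<xi>\<in>couplings \<mu> \<nu>.
        ennreal_powr (\<integral>\<^sup>+ (x, y). ennreal (nrm (x - y) powr p) \<partial>\<xi>) (1 / p))"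

definition empirical_measure :: "nat \<Rightarrow> (nat \<Rightarrow> 'a::topological_space) \<Rightarrow> 'a measure" where
  "empirical_measure N x =
     measure_of UNIV (sets borel)
       (\<lambda>A. ennreal (1 / real N) * (\<Sum>j = 1..N. emeasure (return borel (x j)) A))"

lemma sets_empirical_measure [simp]: "sets (empirical_measure N x) = sets borel"
  using sets.sets_measure_of_eq[of "borel :: 'a measure"] by (simp add: empirical_measure_def)

lemma space_empirical_measure [simp]: "space (empirical_measure N x) = UNIV"
  by (simp add: empirical_measure_def space_measure_of_conv)

lemma emeasure_empirical_measure:
  assumes "A \<in> sets borel"
  shows "emeasure (empirical_measure N x) A =
    ennreal (1 / real N) * (\<Sum>j = 1..N. emeasure (return borel (x j)) A)"
proof -
  let ?f = "\<lambda>A. ennreal (1 / real N) * (\<Sum>j = 1..N. emeasure (return borel (x j)) A)"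
  have "countably_additive (sets borel) ?f"
  proof (rule countably_additiveI)
    fix B :: "nat \<Rightarrow> 'a set"
    assume B: "range B \<subseteq> sets borel" "disjoint_family B" "(\<Union>i. B i) \<in> sets borel"
    have "(\<Sum>i. ?f (B i)) = ennreal (1 / real N) * (\<Sum>j = 1..N. \<Sum>i. emeasure (return borel (x j)) (B i))"
      by (simp add: suminf_sum)
    also have "\<dots> = ?f (\<Union>i. B i)"
      using B by (intro arg_cong[where f = "\<lambda>y. _ * y"] sum.cong refl suminf_emeasure) auto
    finally show "(\<Sum>i. ?f (B i)) = ?f (\<Union>i. B i)" .
  qed
  moreover have "positive (sets borel) ?f"
    by (simp add: positive_def)
  moreover have "sigma_algebra UNIV (sets (borel :: 'a measure))"
    using sets.sigma_algebra_axioms[of "borel :: 'a measure"] by simp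
  ultimately show ?thesis
    using assms by (simp add: empirical_measure_def emeasure_measure_of_sigma)
qed

lemma prob_space_empirical_measure:
  assumes "N \<ge> 1"
  shows "prob_space (empirical_measure N x)"
proof (rule prob_spaceI)
  have "(\<Sum>j = 1..N. emeasure (return borel (x j)) UNIV) = ennreal (real N)"
    by (simp add: ennreal_of_nat_eq_real_of_nat)
  then show "emeasure (empirical_measure N x) (space (empirical_measure N x)) = 1"
    using assms by (simp add: emeasure_empirical_measure flip: ennreal_mult)
qed

text \<open>The sample is realised on its canonical space, the \<open>N\<close>-fold product of \<open>\<mu>\<close>, as the coordinate
  functions \<open>X 1, \<dots>, X N\<close>; the lemmas below show that these are i.i.d. with law \<open>\<mu>\<close>.
  The integrand is Borel for norms on \<open>\<real>\<^sup>d\<close>: the cost of splitting \<open>\<mu>\<close> into \<open>N\<close> parts of mass \<open>1/N\<close>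
  and transporting the \<open>j\<close>th part to \<open>X j\<close> is continuous in \<open>X\<close> or identically \<open>\<infinity>\<close>, and the integrand
  is the infimum of these costs over all splittings.\<close>

definition rand_quantization_error ::
  "('a::real_normed_vector \<Rightarrow> real) \<Rightarrow> real \<Rightarrow> nat \<Rightarrow> 'a measure \<Rightarrow> ennreal" where
  "rand_quantization_error nrm p N \<mu> =
     ennreal_powr
       (\<integral>\<^sup>+ X. ennreal_powr (wasserstein nrm p \<mu> (empirical_measure N X)) p \<partial>(\<Pi>\<^sub>M j\<in>{1..N}. \<mu>))
       (1 / p)"

lemma distr_coordinate_sample:
  fixes N :: nat
  assumes "prob_space \<mu>" "j \<in> {1..N}"
  shows "distr (\<Pi>\<^sub>M j\<in>{1..N}. \<mu>) \<mu> (\<lambda>X. X j) = \<mu>"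
  using distr_PiM_component[of "{1..N}" "\<lambda>_. \<mu>" j] assms by simp

lemma indep_vars_coordinate_sample:
  fixes N :: nat
  assumes "prob_space \<mu>" "N \<ge> 1"
  shows "prob_space.indep_vars (\<Pi>\<^sub>M j\<in>{1..N}. \<mu>) (\<lambda>_. \<mu>) (\<lambda>j X. X j) {1..N}"
proof -
  let ?P = "\<Pi>\<^sub>M j\<in>{1..N}. \<mu>"
  interpret P: prob_space ?P
    using assms by (intro prob_space_PiM)
  have "distr ?P ?P (\<lambda>X. \<lambda>j\<in>{1..N}. X j) = distr ?P ?P (\<lambda>X. X)"
    by (rule distr_cong) (auto simp: space_PiM)
  also have "\<dots> = ?P"
    by (rule distr_id2) (rule refl)
  also have "\<dots> = (\<Pi>\<^sub>M j\<in>{1..N}. distr ?P \<mu> (\<lambda>X. X j))"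
    by (intro PiM_cong refl distr_coordinate_sample[symmetric] assms(1))
  finally have "distr ?P ?P (\<lambda>X. \<lambda>j\<in>{1..N}. X j) = (\<Pi>\<^sub>M j\<in>{1..N}. distr ?P \<mu> (\<lambda>X. X j))" .
  moreover have "{1..N} \<noteq> {}"
    using assms by simp
  ultimately show ?thesis
    by (subst P.indep_vars_iff_distr_eq_PiM') simp_all
qed

end

theory Submission
  imports Defs
begin

text \<open>
  Cut \<open>\<real>\<^sup>d\<close> into the shells \<open>2\<^sup>n\<^sup>-\<^sup>1 r < |x| \<le> 2\<^sup>n r\<close> and each shell into dyadic cells of side \<open>2\<^sup>n\<^sup>-\<^sup>l r\<close>.
  Two probability measures \<open>\<mu>, \<nu>\<close> are coupled greedily from the finest level upwards: in every cell
  as much mass as possible is matched, and the rest is passed on to the next coarser level. After a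
  level has been treated, the mass left in a cell \<open>A\<close> is exactly \<open>|\<mu> A - \<nu> A|\<close>, so \<open>\<rho>\<^sub>p\<^sup>p\<close> is bounded by a
  sum of \<open>|\<mu> A - \<nu> A|\<close> weighted with the \<open>p\<close>th powers of the cell diameters.

  If \<open>\<nu>\<close> is the empirical measure, then \<open>E |\<mu> A - \<nu> A|\<close> is at most \<open>2 \<mu> A\<close> and \<open>(\<mu> A / N)\<^sup>1\<^sup>/\<^sup>2\<close>. Summed over
  the \<open>O(2\<^sup>d\<^sup>l)\<close> cells of a shell of mass at most \<open>\<epsilon>\<close> this gives \<open>O(\<epsilon>\<^sup>1\<^sup>-\<^sup>s (2\<^sup>d\<^sup>l / N)\<^sup>s)\<close> for every \<open>s \<le> 1/2\<close>.
  By Markov's inequality \<open>\<epsilon> = O(2\<^sup>-\<^sup>q\<^sup>n)\<close>. If \<open>s > p/d\<close>, the sum over the levels is dominated by the finest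
  level \<open>2\<^sup>L \<approx> N\<^sup>1\<^sup>/\<^sup>d\<close>; if \<open>p < q (1 - s)\<close>, the sum over the shells converges. Both can be achieved because
  \<open>p < d/2\<close> and \<open>q > dp/(d - p)\<close>.
\<close>

subsection \<open>Couplings from nested partitions\<close>

text \<open>Each \<open>x\<close> lies in exactly one fibre of \<open>g\<close>, so
  \<open>W (g x) * u x\<close> is a sum over cells with at most one nonzero term, and Tonelli moves
  that sum outside. This is how weights that are constant on cells become sums over cells.\<close>

lemma nn_integral_cells:
  fixes g :: "'a::topological_space \<Rightarrow> 'c::countable" and W :: "'c \<Rightarrow> ennreal"
  assumes [measurable]: "g \<in> measurable borel (count_space UNIV)" "u \<in> borel_measurable M"
    and [measurable_cong]: "sets M = sets borel"
  shows "(\<integral>\<^sup>+ x. W (g x) * u x \<partial>M) =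
    (\<integral>\<^sup>+ i. W i * (\<integral>\<^sup>+ x. u x * indicator (g -` {i}) x \<partial>M) \<partial>count_space UNIV)"
proof -
  have [measurable]: "g -` {i} \<in> sets M" for i
    using measurable_sets_borel[OF assms(1), of "{i}"] assms(3) by simp
  have "W (g x) * u x = (\<integral>\<^sup>+ i. W i * (u x * indicator (g -` {i}) x) \<partial>count_space UNIV)" for x
  proof -
    have "(\<integral>\<^sup>+ i. W i * (u x * indicator (g -` {i}) x) \<partial>count_space UNIV) =
        (\<integral>\<^sup>+ i. (W (g x) * u x) * indicator {g x} i \<partial>count_space UNIV)"
      by (intro nn_integral_cong) (auto split: split_indicator)
    then show ?thesis
      by (subst (asm) nn_integral_cmult) auto
  qed
  then have "(\<integral>\<^sup>+ x. W (g x) * u x \<partial>M) =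
      (\<integral>\<^sup>+ x. (\<integral>\<^sup>+ i. W i * (u x * indicator (g -` {i}) x) \<partial>count_space UNIV) \<partial>M)"
    by simp
  also have "\<dots> = (\<integral>\<^sup>+ i. (\<integral>\<^sup>+ x. W i * (u x * indicator (g -` {i}) x) \<partial>M) \<partial>count_space UNIV)"
    by (rule nn_integral_count_space_nn_integral) auto
  also have "\<dots> = (\<integral>\<^sup>+ i. W i * (\<integral>\<^sup>+ x. u x * indicator (g -` {i}) x \<partial>M) \<partial>count_space UNIV)"
    by (intro nn_integral_cong nn_integral_cmult) measurable
  finally show ?thesis .
qed

locale borel_prob_pair = pair_prob_space \<mu> \<nu>
  for \<mu> \<nu> :: "'a::second_countable_topology measure" +
  assumes sets_fst [measurable_cong]: "sets \<mu> = sets borel"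
    and sets_snd [measurable_cong]: "sets \<nu> = sets borel"
begin

lemma space_marginals [simp]: "space \<mu> = UNIV" "space \<nu> = UNIV"
  using sets_eq_imp_space_eq[OF sets_fst] sets_eq_imp_space_eq[OF sets_snd] by simp_all

text \<open>
  \<open>h\<close> is the density, with respect to \<open>\<mu> \<otimes> \<nu>\<close>, of the mass matched so far; \<open>f\<close> and \<open>e\<close> are the densities
  of what is left of \<open>\<mu>\<close> and \<open>\<nu>\<close>. Mass is matched only within cells of \<open>g\<close>.
\<close>

definition partial_matching ::
  "('a \<Rightarrow> 'c) \<Rightarrow> ('a \<Rightarrow> ennreal) \<Rightarrow> ('a \<Rightarrow> ennreal) \<Rightarrow> ('a \<times> 'a \<Rightarrow> ennreal) \<Rightarrow> bool" where
  "partial_matching g f e h \<longleftrightarrow>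
     f \<in> borel_measurable borel \<and> e \<in> borel_measurable borel \<and>
     h \<in> borel_measurable (borel \<Otimes>\<^sub>M borel) \<and>
     (\<forall>x. (\<integral>\<^sup>+ y. h (x, y) \<partial>\<nu>) + f x = 1) \<and>
     (\<forall>y. (\<integral>\<^sup>+ x. h (x, y) \<partial>\<mu>) + e y = 1) \<and>
     (\<forall>x y. g x \<noteq> g y \<longrightarrow> h (x, y) = 0)"

text \<open>Arithmetic of the greedy step for the residual masses \<open>a\<close> and
  \<open>b\<close> of one cell: \<open>min a b\<close> gets matched, \<open>min a b / a\<close> is
  the matched fraction on one side, and dividing by \<open>a * b\<close> normalises the product
  measure. The bounds by 1 exclude infinite values, and \<open>0 / 0 = 0\<close> settles an empty
  side.\<close>

lemma ennreal_split_min: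
  fixes a b :: ennreal
  assumes "a \<le> 1" "b \<le> 1"
  shows "min a b / a \<le> 1" "min a b / (a * b) * b = min a b / a" "a * (1 - min a b / a) = a - min a b"
proof -
  obtain a' where a: "a = ennreal a'" "0 \<le> a'"
    using assms by (cases a) (auto simp: top_unique)
  obtain b' where b: "b = ennreal b'" "0 \<le> b'"
    using assms by (cases b) (auto simp: top_unique)
  have m: "min a b = ennreal (min a' b')"
    using a b by (auto simp: min_def)
  consider "a' = 0" | "b' = 0" "a' > 0" | "a' > 0" "b' > 0" using a b by fastforce
  then have "min a b / a \<le> 1 \<and> min a b / (a * b) * b = min a b / a \<and>
      a * (1 - min a b / a) = a - min a b"
  proof cases
    case 3
    have q: "min a b / a = ennreal (min a' b' / a')"
      unfolding m using a b 3 by (simp add: divide_ennreal)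
    have 1: "min a b / a \<le> 1"
      unfolding q using 3 by simp
    have "min a b / (a * b) = ennreal (min a' b' / (a' * b'))"
      unfolding m using a b 3 by (simp add: divide_ennreal flip: ennreal_mult)
    then have 2: "min a b / (a * b) * b = min a b / a"
      unfolding q using a b 3 by (simp flip: ennreal_mult)
    have "a * (1 - min a b / a) = ennreal (a' * (1 - min a' b' / a'))"
      unfolding q using a b 3 by (simp add: ennreal_minus ennreal_mult flip: ennreal_1)
    also have "a' * (1 - min a' b' / a') = a' - min a' b'"
      using 3 by (simp add: field_simps)
    finally have "a * (1 - min a b / a) = a - min a b"
      unfolding m using a b by (simp add: ennreal_minus)
    with 1 2 show ?thesis by blast
  qed (use a b in \<open>auto simp: zero_ennreal_def[symmetric]\<close>)
  then show "min a b / a \<le> 1" "min a b / (a * b) * b = min a b / a"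
      "a * (1 - min a b / a) = a - min a b" by blast+
qed

text \<open>One greedy step. In every cell of the coarser partition \<open>g'\<close> the side with
  less residual mass is used up entirely, whence the disjunction. A newly matched pair costs at most
  \<open>w x + w y\<close>, so the extra cost splits into one integral per side, each against mass
  that was still residual before the step.\<close>

lemma match_step:
  fixes g :: "'a \<Rightarrow> 'c" and g' :: "'a \<Rightarrow> 'd::countable"
  assumes pm: "partial_matching g f e h"
    and g'[measurable]: "g' \<in> measurable borel (count_space UNIV)"
    and coarser: "\<And>x y. g x = g y \<Longrightarrow> g' x = g' y"
    and c[measurable]: "c \<in> borel_measurable (borel \<Otimes>\<^sub>M borel)"
    and w[measurable]: "w \<in> borel_measurable borel"
    and cw: "\<And>x y. g' x = g' y \<Longrightarrow> c (x, y) \<le> w x + w y"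
  obtains f' e' h' where "partial_matching g' f' e' h'"
    "\<And>i. (\<integral>\<^sup>+ x. f' x * indicator (g' -` {i}) x \<partial>\<mu>) = 0 \<or> (\<integral>\<^sup>+ x. e' x * indicator (g' -` {i}) x \<partial>\<nu>) = 0"
    "(\<integral>\<^sup>+ z. c z * h' z \<partial>(\<mu> \<Otimes>\<^sub>M \<nu>)) \<le>
       (\<integral>\<^sup>+ z. c z * h z \<partial>(\<mu> \<Otimes>\<^sub>M \<nu>)) + ((\<integral>\<^sup>+ x. w x * f x \<partial>\<mu>) + (\<integral>\<^sup>+ y. w y * e y \<partial>\<nu>))"
proof -
  have [measurable]: "f \<in> borel_measurable borel" "e \<in> borel_measurable borel"
      "h \<in> borel_measurable (borel \<Otimes>\<^sub>M borel)"
    using pm by (auto simp: partial_matching_def)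
  have hf: "(\<integral>\<^sup>+ y. h (x, y) \<partial>\<nu>) + f x = 1" and he: "(\<integral>\<^sup>+ x. h (x, y) \<partial>\<mu>) + e y = 1" for x y
    using pm by (auto simp: partial_matching_def)
  have f1: "f x \<le> 1" for x
    using hf[of x] by (metis add_increasing order_refl zero_le)
  have e1: "e x \<le> 1" for x
    using he[of x] by (metis add_increasing order_refl zero_le)
  define a where "a i = (\<integral>\<^sup>+ x. f x * indicator (g' -` {i}) x \<partial>\<mu>)" for i
  define b where "b i = (\<integral>\<^sup>+ x. e x * indicator (g' -` {i}) x \<partial>\<nu>)" for i
  have a1: "a i \<le> 1" for i
  proof -
    have "a i \<le> (\<integral>\<^sup>+ x. 1 \<partial>\<mu>)"
      unfolding a_def using f1 by (intro nn_integral_mono) (auto split: split_indicator)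
    then show ?thesis by (simp add: M1.emeasure_space_1[simplified])
  qed
  have b1: "b i \<le> 1" for i
  proof -
    have "b i \<le> (\<integral>\<^sup>+ x. 1 \<partial>\<nu>)"
      unfolding b_def using e1 by (intro nn_integral_mono) (auto split: split_indicator)
    then show ?thesis by (simp add: M2.emeasure_space_1[simplified])
  qed
  define m where "m i = min (a i) (b i)" for i
  define t where "t i = m i / a i" for i
  define s where "s i = m i / b i" for i
  define \<kappa> where "\<kappa> i = m i / (a i * b i)" for i
  have t: "t i \<le> 1" "\<kappa> i * b i = t i" "a i * (1 - t i) = a i - m i" for i
    using ennreal_split_min[OF a1[of i] b1[of i]] unfolding t_def \<kappa>_def m_def by auto
  have s: "s i \<le> 1" "\<kappa> i * a i = s i" "b i * (1 - s i) = b i - m i" for i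
    using ennreal_split_min[OF b1[of i] a1[of i]] unfolding s_def \<kappa>_def m_def
    by (auto simp: min.commute mult.commute)
  \<comment> \<open>Inside a cell \<open>i\<close> the two residual measures, of masses \<open>a i\<close> and \<open>b i\<close>, are matched by the multiple of
      their product with total mass \<open>m i\<close>. Where \<open>a i\<close> or \<open>b i\<close> vanishes, so does \<open>m i\<close>, and \<open>0 / 0 = 0\<close> on \<open>[0, \<infinity>]\<close>.\<close>
  define k where "k = (\<lambda>(x, y). if g' x = g' y then f x * e y * \<kappa> (g' x) else 0)"
  have [measurable]: "Measurable.pred (borel \<Otimes>\<^sub>M borel) (\<lambda>z. g' (fst z) = g' (snd z))"
    by measurable
  have tm[measurable]: "(\<lambda>x. r (g' x)) \<in> borel_measurable borel" for r :: "'d \<Rightarrow> ennreal"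
    by measurable
  have [measurable]: "(\<lambda>z. \<kappa> (g' (fst z))) \<in> borel_measurable (borel \<Otimes>\<^sub>M borel)"
    by (rule measurable_compose[OF measurable_fst tm])
  have [measurable]: "k \<in> borel_measurable (borel \<Otimes>\<^sub>M borel)"
    unfolding k_def case_prod_beta by measurable
  have kx: "(\<integral>\<^sup>+ y. k (x, y) \<partial>\<nu>) = f x * t (g' x)" for x
  proof -
    have "(\<integral>\<^sup>+ y. k (x, y) \<partial>\<nu>) = (\<integral>\<^sup>+ y. (f x * \<kappa> (g' x)) * (e y * indicator (g' -` {g' x}) y) \<partial>\<nu>)"
      by (intro nn_integral_cong) (auto simp: k_def split: split_indicator simp: mult_ac)
    also have "\<dots> = f x * \<kappa> (g' x) * b (g' x)"
      unfolding b_def by (subst nn_integral_cmult) (auto intro: measurable_sets_borel)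
    finally show ?thesis by (simp add: t(2)[symmetric] mult.assoc)
  qed
  have ky: "(\<integral>\<^sup>+ x. k (x, y) \<partial>\<mu>) = e y * s (g' y)" for y
  proof -
    have "(\<integral>\<^sup>+ x. k (x, y) \<partial>\<mu>) = (\<integral>\<^sup>+ x. (e y * \<kappa> (g' y)) * (f x * indicator (g' -` {g' y}) x) \<partial>\<mu>)"
      by (intro nn_integral_cong) (auto simp: k_def split: split_indicator simp: mult_ac)
    also have "\<dots> = e y * \<kappa> (g' y) * a (g' y)"
      unfolding a_def by (subst nn_integral_cmult) (auto intro: measurable_sets_borel)
    finally show ?thesis by (simp add: s(2)[symmetric] mult.assoc)
  qed
  define f' where "f' x = f x * (1 - t (g' x))" for x
  define e' where "e' x = e x * (1 - s (g' x))" for x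
  define h' where "h' z = h z + k z" for z
  have [measurable]: "f' \<in> borel_measurable borel" "e' \<in> borel_measurable borel"
    unfolding f'_def[abs_def] e'_def[abs_def] by measurable
  have [measurable]: "h' \<in> borel_measurable (borel \<Otimes>\<^sub>M borel)"
    unfolding h'_def[abs_def] by measurable
  have "partial_matching g' f' e' h'"
    unfolding partial_matching_def
  proof (intro conjI allI impI)
    fix x
    have "(\<integral>\<^sup>+ y. h' (x, y) \<partial>\<nu>) = (\<integral>\<^sup>+ y. h (x, y) \<partial>\<nu>) + f x * t (g' x)"
      unfolding h'_def by (subst nn_integral_add) (auto simp: kx)
    moreover have "f x * t (g' x) + f' x = f x"
      using t(1)[of "g' x"] by (simp add: f'_def add_diff_inverse_ennreal flip: distrib_left)
    ultimately show "(\<integral>\<^sup>+ y. h' (x, y) \<partial>\<nu>) + f' x = 1"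
      using hf[of x] by (simp add: add.assoc)
    have "(\<integral>\<^sup>+ y. h' (y, x) \<partial>\<mu>) = (\<integral>\<^sup>+ y. h (y, x) \<partial>\<mu>) + e x * s (g' x)"
      unfolding h'_def by (subst nn_integral_add) (auto simp: ky)
    moreover have "e x * s (g' x) + e' x = e x"
      using s(1)[of "g' x"] by (simp add: e'_def add_diff_inverse_ennreal flip: distrib_left)
    ultimately show "(\<integral>\<^sup>+ y. h' (y, x) \<partial>\<mu>) + e' x = 1"
      using he[of x] by (simp add: add.assoc)
    \<comment> \<open>\<open>h\<close> vanishes across cells of the finer \<open>g\<close>, hence
      across cells of \<open>g'\<close>, and \<open>k\<close> does so by construction.\<close>
    fix y assume "g' x \<noteq> g' y"
    then show "h' (x, y) = 0"
      using pm coarser[of x y] by (auto simp: h'_def k_def partial_matching_def)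
  qed measurable
  moreover have "(\<integral>\<^sup>+ x. f' x * indicator (g' -` {i}) x \<partial>\<mu>) = 0 \<or>
      (\<integral>\<^sup>+ x. e' x * indicator (g' -` {i}) x \<partial>\<nu>) = 0" for i
  proof -
    have "(\<integral>\<^sup>+ x. f' x * indicator (g' -` {i}) x \<partial>\<mu>) =
        (\<integral>\<^sup>+ x. (f x * indicator (g' -` {i}) x) * (1 - t i) \<partial>\<mu>)"
      by (intro nn_integral_cong) (auto simp: f'_def split: split_indicator)
    also have "\<dots> = a i - m i"
      unfolding a_def t(3)[symmetric, unfolded a_def] by (subst nn_integral_multc) (auto intro: measurable_sets_borel)
    finally have 1: "(\<integral>\<^sup>+ x. f' x * indicator (g' -` {i}) x \<partial>\<mu>) = a i - m i" .
    have "(\<integral>\<^sup>+ x. e' x * indicator (g' -` {i}) x \<partial>\<nu>) =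
        (\<integral>\<^sup>+ x. (e x * indicator (g' -` {i}) x) * (1 - s i) \<partial>\<nu>)"
      by (intro nn_integral_cong) (auto simp: e'_def split: split_indicator)
    also have "\<dots> = b i - m i"
      unfolding b_def s(3)[symmetric, unfolded b_def] by (subst nn_integral_multc) (auto intro: measurable_sets_borel)
    finally have 2: "(\<integral>\<^sup>+ x. e' x * indicator (g' -` {i}) x \<partial>\<nu>) = b i - m i" .
    \<comment> \<open>In \<open>ennreal\<close>, \<open>top - top = top\<close>, so finiteness is
      what lets the smaller residual vanish.\<close>
    have "a i < top" "b i < top"
      using a1[of i] b1[of i] by (auto intro: le_less_trans)
    then show ?thesis
      unfolding 1 2 by (auto simp: m_def min_def diff_eq_0_iff_ennreal)
  qed
  moreover have "(\<integral>\<^sup>+ z. c z * h' z \<partial>(\<mu> \<Otimes>\<^sub>M \<nu>)) \<le>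
       (\<integral>\<^sup>+ z. c z * h z \<partial>(\<mu> \<Otimes>\<^sub>M \<nu>)) + ((\<integral>\<^sup>+ x. w x * f x \<partial>\<mu>) + (\<integral>\<^sup>+ y. w y * e y \<partial>\<nu>))"
  proof -
    have "(\<integral>\<^sup>+ z. c z * h' z \<partial>(\<mu> \<Otimes>\<^sub>M \<nu>)) =
        (\<integral>\<^sup>+ z. c z * h z \<partial>(\<mu> \<Otimes>\<^sub>M \<nu>)) + (\<integral>\<^sup>+ z. c z * k z \<partial>(\<mu> \<Otimes>\<^sub>M \<nu>))"
      unfolding h'_def distrib_left by (rule nn_integral_add) auto
    also have "(\<integral>\<^sup>+ z. c z * k z \<partial>(\<mu> \<Otimes>\<^sub>M \<nu>)) \<le>
        (\<integral>\<^sup>+ z. w (fst z) * k z + w (snd z) * k z \<partial>(\<mu> \<Otimes>\<^sub>M \<nu>))"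
    proof (rule nn_integral_mono)
      fix z :: "'a \<times> 'a"
      show "c z * k z \<le> w (fst z) * k z + w (snd z) * k z"
        using cw[of "fst z" "snd z"]
        by (cases "g' (fst z) = g' (snd z)")
           (auto simp: k_def case_prod_beta simp flip: distrib_right intro!: mult_right_mono)
    qed
    also have "\<dots> = (\<integral>\<^sup>+ z. w (fst z) * k z \<partial>(\<mu> \<Otimes>\<^sub>M \<nu>)) + (\<integral>\<^sup>+ z. w (snd z) * k z \<partial>(\<mu> \<Otimes>\<^sub>M \<nu>))"
      by (rule nn_integral_add) auto
    also have "(\<integral>\<^sup>+ z. w (fst z) * k z \<partial>(\<mu> \<Otimes>\<^sub>M \<nu>)) = (\<integral>\<^sup>+ x. w x * (\<integral>\<^sup>+ y. k (x, y) \<partial>\<nu>) \<partial>\<mu>)"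
      by (subst M2.nn_integral_fst[symmetric]) (auto simp: nn_integral_cmult)
    also have "\<dots> \<le> (\<integral>\<^sup>+ x. w x * f x \<partial>\<mu>)"
      unfolding kx using t(1) by (intro nn_integral_mono mult_left_mono) (auto intro!: mult_left_le)
    also have "(\<integral>\<^sup>+ z. w (snd z) * k z \<partial>(\<mu> \<Otimes>\<^sub>M \<nu>)) = (\<integral>\<^sup>+ y. w y * (\<integral>\<^sup>+ x. k (x, y) \<partial>\<mu>) \<partial>\<nu>)"
      by (subst nn_integral_snd[symmetric]) (auto simp: nn_integral_cmult)
    also have "\<dots> \<le> (\<integral>\<^sup>+ y. w y * e y \<partial>\<nu>)"
      unfolding ky using s(1) by (intro nn_integral_mono mult_left_mono) (auto intro!: mult_left_le)
    finally show ?thesis by (simp add: add_mono)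
  qed
  ultimately show ?thesis
    using that by blast
qed

text \<open>\<open>h\<close> never couples different cells, so the mass \<open>H\<close> matched
  inside the cell is the same seen from either marginal. The residuals are then
  \<open>\<mu> A - H\<close> and \<open>\<nu> A - H\<close>; as one of them is 0, their sum is the
  absolute difference.\<close>

lemma residual_cell:
  assumes pm: "partial_matching g f e h" and A[measurable]: "g -` {i} \<in> sets borel"
    and disj: "(\<integral>\<^sup>+ x. f x * indicator (g -` {i}) x \<partial>\<mu>) = 0 \<or> (\<integral>\<^sup>+ x. e x * indicator (g -` {i}) x \<partial>\<nu>) = 0"
  shows "(\<integral>\<^sup>+ x. f x * indicator (g -` {i}) x \<partial>\<mu>) + (\<integral>\<^sup>+ x. e x * indicator (g -` {i}) x \<partial>\<nu>) =
    ennreal \<bar>measure \<mu> (g -` {i}) - measure \<nu> (g -` {i})\<bar>"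
proof -
  let ?A = "g -` {i}"
  have [measurable]: "f \<in> borel_measurable borel" "e \<in> borel_measurable borel"
      "h \<in> borel_measurable (borel \<Otimes>\<^sub>M borel)"
    using pm by (auto simp: partial_matching_def)
  define H where "H = (\<integral>\<^sup>+ z. h z * indicator ?A (fst z) \<partial>(\<mu> \<Otimes>\<^sub>M \<nu>))"
  have H': "H = (\<integral>\<^sup>+ z. h z * indicator ?A (snd z) \<partial>(\<mu> \<Otimes>\<^sub>M \<nu>))"
    unfolding H_def
  proof (rule nn_integral_cong)
    fix z :: "'a \<times> 'a"
    show "h z * indicator ?A (fst z) = h z * indicator ?A (snd z)"
      using pm by (cases z) (auto simp: partial_matching_def split: split_indicator)
  qed
  have "H = (\<integral>\<^sup>+ x. (\<integral>\<^sup>+ y. h (x, y) \<partial>\<nu>) * indicator ?A x \<partial>\<mu>)"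
    unfolding H_def by (subst M2.nn_integral_fst[symmetric]) (auto simp: nn_integral_multc)
  then have "H + (\<integral>\<^sup>+ x. f x * indicator ?A x \<partial>\<mu>) =
      (\<integral>\<^sup>+ x. ((\<integral>\<^sup>+ y. h (x, y) \<partial>\<nu>) + f x) * indicator ?A x \<partial>\<mu>)"
    by (simp add: distrib_right nn_integral_add)
  also have "\<dots> = emeasure \<mu> ?A"
    using pm by (simp add: partial_matching_def)
  finally have 1: "H + (\<integral>\<^sup>+ x. f x * indicator ?A x \<partial>\<mu>) = ennreal (measure \<mu> ?A)"
    by (simp add: M1.emeasure_eq_measure)
  have "H = (\<integral>\<^sup>+ y. (\<integral>\<^sup>+ x. h (x, y) \<partial>\<mu>) * indicator ?A y \<partial>\<nu>)"
    unfolding H' by (subst nn_integral_snd[symmetric]) (auto simp: nn_integral_multc)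
  then have "H + (\<integral>\<^sup>+ y. e y * indicator ?A y \<partial>\<nu>) =
      (\<integral>\<^sup>+ y. ((\<integral>\<^sup>+ x. h (x, y) \<partial>\<mu>) + e y) * indicator ?A y \<partial>\<nu>)"
    by (simp add: distrib_right nn_integral_add)
  also have "\<dots> = emeasure \<nu> ?A"
    using pm by (simp add: partial_matching_def)
  finally have 2: "H + (\<integral>\<^sup>+ y. e y * indicator ?A y \<partial>\<nu>) = ennreal (measure \<nu> ?A)"
    by (simp add: M2.emeasure_eq_measure)
  obtain H' where H: "H = ennreal H'" "H' \<ge> 0"
    using 1 by (cases H) auto
  obtain a where a: "(\<integral>\<^sup>+ x. f x * indicator ?A x \<partial>\<mu>) = ennreal a" "a \<ge> 0"
    using 1 by (cases "\<integral>\<^sup>+ x. f x * indicator ?A x \<partial>\<mu>") auto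
  obtain b where b: "(\<integral>\<^sup>+ x. e x * indicator ?A x \<partial>\<nu>) = ennreal b" "b \<ge> 0"
    using 2 by (cases "\<integral>\<^sup>+ x. e x * indicator ?A x \<partial>\<nu>") auto
  have "H' + a = measure \<mu> ?A" "H' + b = measure \<nu> ?A"
    using 1 2 H a b by (simp_all flip: ennreal_plus)
  moreover have "a = 0 \<or> b = 0"
    using disj a b by simp
  ultimately have "a + b = \<bar>measure \<mu> ?A - measure \<nu> ?A\<bar>"
    using a b by linarith
  then show ?thesis
    using a b by (simp flip: ennreal_plus)
qed

text \<open>Levels are treated from fine to coarse. Everything starts out residual, so level 0 pays
  \<open>w\<close> against the full measures. What survives level \<open>k\<close> in a cell has
  mass equal to the discrepancy there and is offered for matching inside a cell of level
  \<open>k + 1\<close>; hence \<open>W k\<close> bounds costs within cells of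
  \<open>g (Suc k)\<close> although it is summed over cells of \<open>g k\<close>.\<close>

lemma iterated_matching:
  fixes g :: "nat \<Rightarrow> 'a \<Rightarrow> 'c::countable" and W :: "nat \<Rightarrow> 'c \<Rightarrow> ennreal"
  assumes g[measurable]: "\<And>k. g k \<in> measurable borel (count_space UNIV)"
    and nested: "\<And>k x y. g k x = g k y \<Longrightarrow> g (Suc k) x = g (Suc k) y"
    and c[measurable]: "c \<in> borel_measurable (borel \<Otimes>\<^sub>M borel)"
    and w[measurable]: "w \<in> borel_measurable borel"
    and c0: "\<And>x y. g 0 x = g 0 y \<Longrightarrow> c (x, y) \<le> w x + w y"
    and cW: "\<And>k x y. k < K \<Longrightarrow> g (Suc k) x = g (Suc k) y \<Longrightarrow> c (x, y) \<le> W k (g k x) + W k (g k y)"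
  shows "\<exists>f e h. partial_matching (g K) f e h \<and>
    (\<forall>i. (\<integral>\<^sup>+ x. f x * indicator (g K -` {i}) x \<partial>\<mu>) = 0 \<or> (\<integral>\<^sup>+ x. e x * indicator (g K -` {i}) x \<partial>\<nu>) = 0) \<and>
    (\<integral>\<^sup>+ z. c z * h z \<partial>(\<mu> \<Otimes>\<^sub>M \<nu>)) \<le> (\<integral>\<^sup>+ x. w x \<partial>\<mu>) + (\<integral>\<^sup>+ x. w x \<partial>\<nu>) +
      (\<Sum>k<K. \<integral>\<^sup>+ i. W k i * ennreal \<bar>measure \<mu> (g k -` {i}) - measure \<nu> (g k -` {i})\<bar> \<partial>count_space UNIV)"
  using cW
proof (induction K)
  case 0
  have "partial_matching (g 0) (\<lambda>_. 1) (\<lambda>_. 1) (\<lambda>_. 0)"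
    by (simp add: partial_matching_def)
  moreover have "\<And>x y. g 0 x = g 0 y \<Longrightarrow> g 0 x = g 0 y" .
  ultimately obtain f' e' h' where "partial_matching (g 0) f' e' h'"
    and "\<And>i. (\<integral>\<^sup>+ x. f' x * indicator (g 0 -` {i}) x \<partial>\<mu>) = 0 \<or> (\<integral>\<^sup>+ x. e' x * indicator (g 0 -` {i}) x \<partial>\<nu>) = 0"
    and "(\<integral>\<^sup>+ z. c z * h' z \<partial>(\<mu> \<Otimes>\<^sub>M \<nu>)) \<le>
      (\<integral>\<^sup>+ z. c z * 0 \<partial>(\<mu> \<Otimes>\<^sub>M \<nu>)) + ((\<integral>\<^sup>+ x. w x * 1 \<partial>\<mu>) + (\<integral>\<^sup>+ y. w y * 1 \<partial>\<nu>))"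
    using match_step[OF _ g[of 0] _ c w c0] by blast
  then show ?case
    by (intro exI[of _ f'] exI[of _ e'] exI[of _ h']) simp
next
  case (Suc K)
  from Suc obtain f e h where pm: "partial_matching (g K) f e h"
    and disj: "\<And>i. (\<integral>\<^sup>+ x. f x * indicator (g K -` {i}) x \<partial>\<mu>) = 0 \<or> (\<integral>\<^sup>+ x. e x * indicator (g K -` {i}) x \<partial>\<nu>) = 0"
    and cost: "(\<integral>\<^sup>+ z. c z * h z \<partial>(\<mu> \<Otimes>\<^sub>M \<nu>)) \<le> (\<integral>\<^sup>+ x. w x \<partial>\<mu>) + (\<integral>\<^sup>+ x. w x \<partial>\<nu>) +
      (\<Sum>k<K. \<integral>\<^sup>+ i. W k i * ennreal \<bar>measure \<mu> (g k -` {i}) - measure \<nu> (g k -` {i})\<bar> \<partial>count_space UNIV)"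
    by fastforce
  have [measurable]: "f \<in> borel_measurable borel" "e \<in> borel_measurable borel"
    using pm by (auto simp: partial_matching_def)
  have WK: "(\<lambda>x. W K (g K x)) \<in> borel_measurable borel"
    by measurable
  have cells: "g K -` {i} \<in> sets borel" for i
    by (rule measurable_sets_borel[OF g]) simp
  obtain f' e' h' where pm': "partial_matching (g (Suc K)) f' e' h'"
    and disj': "\<And>i. (\<integral>\<^sup>+ x. f' x * indicator (g (Suc K) -` {i}) x \<partial>\<mu>) = 0 \<or> (\<integral>\<^sup>+ x. e' x * indicator (g (Suc K) -` {i}) x \<partial>\<nu>) = 0"
    and cost': "(\<integral>\<^sup>+ z. c z * h' z \<partial>(\<mu> \<Otimes>\<^sub>M \<nu>)) \<le> (\<integral>\<^sup>+ z. c z * h z \<partial>(\<mu> \<Otimes>\<^sub>M \<nu>)) +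
      ((\<integral>\<^sup>+ x. W K (g K x) * f x \<partial>\<mu>) + (\<integral>\<^sup>+ y. W K (g K y) * e y \<partial>\<nu>))"
    using match_step[OF pm g[of "Suc K"] nested c WK Suc.prems[of K]] by blast
  \<comment> \<open>\<open>W K\<close> is evaluated at the cell of level \<open>K\<close>, so both
    integrals split into cell residuals, which \<open>residual_cell\<close> adds up to the
    discrepancies.\<close>
  have "(\<integral>\<^sup>+ x. W K (g K x) * f x \<partial>\<mu>) + (\<integral>\<^sup>+ y. W K (g K y) * e y \<partial>\<nu>) =
      (\<integral>\<^sup>+ i. W K i * (\<integral>\<^sup>+ x. f x * indicator (g K -` {i}) x \<partial>\<mu>) +
        W K i * (\<integral>\<^sup>+ x. e x * indicator (g K -` {i}) x \<partial>\<nu>) \<partial>count_space UNIV)"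
    by (subst (1 2) nn_integral_cells) (auto simp: sets_fst sets_snd nn_integral_add)
  also have "\<dots> = (\<integral>\<^sup>+ i. W K i * ennreal \<bar>measure \<mu> (g K -` {i}) - measure \<nu> (g K -` {i})\<bar> \<partial>count_space UNIV)"
    using residual_cell[OF pm cells disj] by (simp flip: distrib_left)
  finally show ?case
    using pm' disj' order_trans[OF cost' add_right_mono[OF cost]]
    by (intro exI[of _ f'] exI[of _ e'] exI[of _ h']) (auto simp: add_ac)
qed

text \<open>If the last partition has a single cell, the residual there is
  \<open>|1 - 1| = 0\<close>: the matching is complete and \<open>h\<close> is the density of a
  genuine coupling.\<close>

lemma coupling_by_nested_partitions:
  fixes g :: "nat \<Rightarrow> 'a \<Rightarrow> 'c::countable" and W :: "nat \<Rightarrow> 'c \<Rightarrow> ennreal"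
  assumes g[measurable]: "\<And>k. g k \<in> measurable borel (count_space UNIV)"
    and nested: "\<And>k x y. g k x = g k y \<Longrightarrow> g (Suc k) x = g (Suc k) y"
    and trivial: "\<And>x y. g K x = g K y"
    and c[measurable]: "c \<in> borel_measurable (borel \<Otimes>\<^sub>M borel)"
    and w[measurable]: "w \<in> borel_measurable borel"
    and c0: "\<And>x y. g 0 x = g 0 y \<Longrightarrow> c (x, y) \<le> w x + w y"
    and cW: "\<And>k x y. k < K \<Longrightarrow> g (Suc k) x = g (Suc k) y \<Longrightarrow> c (x, y) \<le> W k (g k x) + W k (g k y)"
  obtains \<xi> where "\<xi> \<in> couplings \<mu> \<nu>"
    "(\<integral>\<^sup>+ z. c z \<partial>\<xi>) \<le> (\<integral>\<^sup>+ x. w x \<partial>\<mu>) + (\<integral>\<^sup>+ x. w x \<partial>\<nu>) +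
      (\<Sum>k<K. \<integral>\<^sup>+ i. W k i * ennreal \<bar>measure \<mu> (g k -` {i}) - measure \<nu> (g k -` {i})\<bar> \<partial>count_space UNIV)"
proof -
  obtain f e h where pm: "partial_matching (g K) f e h"
    and disj: "\<And>i. (\<integral>\<^sup>+ x. f x * indicator (g K -` {i}) x \<partial>\<mu>) = 0 \<or> (\<integral>\<^sup>+ x. e x * indicator (g K -` {i}) x \<partial>\<nu>) = 0"
    and cost: "(\<integral>\<^sup>+ z. c z * h z \<partial>(\<mu> \<Otimes>\<^sub>M \<nu>)) \<le> (\<integral>\<^sup>+ x. w x \<partial>\<mu>) + (\<integral>\<^sup>+ x. w x \<partial>\<nu>) +
      (\<Sum>k<K. \<integral>\<^sup>+ i. W k i * ennreal \<bar>measure \<mu> (g k -` {i}) - measure \<nu> (g k -` {i})\<bar> \<partial>count_space UNIV)"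
    using iterated_matching[where g=g and W=W and K=K and w=w and c=c, OF g nested c w c0 cW] by blast
  have [measurable]: "f \<in> borel_measurable borel" "e \<in> borel_measurable borel"
      "h \<in> borel_measurable (borel \<Otimes>\<^sub>M borel)"
    using pm by (auto simp: partial_matching_def)
  have U: "g K -` {g K undefined} = UNIV"
    using trivial by auto
  have "(\<integral>\<^sup>+ x. f x \<partial>\<mu>) + (\<integral>\<^sup>+ x. e x \<partial>\<nu>) = 0"
    using residual_cell[OF pm _ disj, of "g K undefined"] M1.prob_space M2.prob_space
    by (simp add: U)
  then have f0: "AE x in \<mu>. f x = 0" and e0: "AE x in \<nu>. e x = 0"
    by (simp_all add: nn_integral_0_iff_AE)
  define \<xi> where "\<xi> = density (\<mu> \<Otimes>\<^sub>M \<nu>) h"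
  have sets_pair: "sets (\<mu> \<Otimes>\<^sub>M \<nu>) = sets (borel \<Otimes>\<^sub>M borel)"
    using sets_pair_measure_cong[OF sets_fst sets_snd] .
  have [measurable_cong]: "sets \<xi> = sets (borel \<Otimes>\<^sub>M borel)"
    by (simp add: \<xi>_def sets_pair)
  have fst: "distr \<xi> borel fst = \<mu>"
  proof (rule measure_eqI)
    fix A assume "A \<in> sets (distr \<xi> borel fst)"
    then have A[measurable]: "A \<in> sets borel" by simp
    have "emeasure (distr \<xi> borel fst) A = (\<integral>\<^sup>+ z. indicator A (fst z) \<partial>\<xi>)"
      by (subst nn_integral_distr[symmetric, where f="indicator A" and M'=borel]) auto
    also have "\<dots> = (\<integral>\<^sup>+ z. h z * indicator A (fst z) \<partial>(\<mu> \<Otimes>\<^sub>M \<nu>))"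
      unfolding \<xi>_def by (rule nn_integral_density) auto
    also have "\<dots> = (\<integral>\<^sup>+ x. (\<integral>\<^sup>+ y. h (x, y) \<partial>\<nu>) * indicator A x \<partial>\<mu>)"
      by (subst M2.nn_integral_fst[symmetric]) (auto simp: nn_integral_multc)
    \<comment> \<open>\<open>f\<close> vanishes almost everywhere, and adding it turns the inner
      factor into the constant 1. The second marginal is treated likewise with
      \<open>e\<close>.\<close>
    also have "\<dots> = (\<integral>\<^sup>+ x. ((\<integral>\<^sup>+ y. h (x, y) \<partial>\<nu>) + f x) * indicator A x \<partial>\<mu>)"
      using f0 by (intro nn_integral_cong_AE) auto
    also have "\<dots> = emeasure \<mu> A"
      using pm by (simp add: partial_matching_def)
    finally show "emeasure (distr \<xi> borel fst) A = emeasure \<mu> A" .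
  qed (simp add: sets_fst)
  have snd: "distr \<xi> borel snd = \<nu>"
  proof (rule measure_eqI)
    fix A assume "A \<in> sets (distr \<xi> borel snd)"
    then have A[measurable]: "A \<in> sets borel" by simp
    have "emeasure (distr \<xi> borel snd) A = (\<integral>\<^sup>+ z. indicator A (snd z) \<partial>\<xi>)"
      by (subst nn_integral_distr[symmetric, where f="indicator A" and M'=borel]) auto
    also have "\<dots> = (\<integral>\<^sup>+ z. h z * indicator A (snd z) \<partial>(\<mu> \<Otimes>\<^sub>M \<nu>))"
      unfolding \<xi>_def by (rule nn_integral_density) auto
    also have "\<dots> = (\<integral>\<^sup>+ y. (\<integral>\<^sup>+ x. h (x, y) \<partial>\<mu>) * indicator A y \<partial>\<nu>)"
      by (subst nn_integral_snd[symmetric]) (auto simp: nn_integral_multc)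
    also have "\<dots> = (\<integral>\<^sup>+ y. ((\<integral>\<^sup>+ x. h (x, y) \<partial>\<mu>) + e y) * indicator A y \<partial>\<nu>)"
      using e0 by (intro nn_integral_cong_AE) auto
    also have "\<dots> = emeasure \<nu> A"
      using pm by (simp add: partial_matching_def)
    finally show "emeasure (distr \<xi> borel snd) A = emeasure \<nu> A" .
  qed (simp add: sets_snd)
  have "emeasure \<xi> (space \<xi>) = emeasure (distr \<xi> borel fst) UNIV"
    by (subst emeasure_distr) auto
  then have "finite_measure \<xi>"
    by (intro finite_measureI) (simp add: fst M1.emeasure_space_1[simplified])
  moreover have "sets \<xi> = sets borel"
    unfolding \<xi>_def by (simp add: sets_pair) (subst borel_prod, rule refl)
  ultimately have "\<xi> \<in> couplings \<mu> \<nu>"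
    using fst snd by (simp add: couplings_def)
  moreover have "(\<integral>\<^sup>+ z. c z \<partial>\<xi>) = (\<integral>\<^sup>+ z. c z * h z \<partial>(\<mu> \<Otimes>\<^sub>M \<nu>))"
    unfolding \<xi>_def by (subst nn_integral_density) (auto simp: mult.commute)
  ultimately show ?thesis
    using that cost by simp
qed

end

subsection \<open>Deviations of the empirical measure\<close>

lemma measure_empirical_measure:
  assumes "A \<in> sets borel"
  shows "measure (empirical_measure N x) A = (\<Sum>j = 1..N. indicator A (x j)) / real N"
proof -
  have "(\<Sum>j = 1..N. emeasure (return borel (x j)) A) = ennreal (\<Sum>j = 1..N. indicator A (x j))"
    using assms by (subst sum_ennreal[symmetric]) (auto simp: ennreal_indicator)
  then show ?thesis
    using assms by (simp add: measure_def emeasure_empirical_measure sum_nonneg flip: ennreal_mult)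
qed

lemma nn_integral_empirical_measure:
  assumes w[measurable]: "w \<in> borel_measurable borel"
  shows "(\<integral>\<^sup>+ y. w y \<partial>empirical_measure N x) = ennreal (1 / real N) * (\<Sum>j = 1..N. w (x j))"
proof -
  \<comment> \<open>Writing the empirical measure as a scaled image of counting measure on the index
    set reduces its integrals to finite sums.\<close>
  have "empirical_measure N x =
      scale_measure (ennreal (1 / real N)) (distr (count_space {1..N}) borel x)"
  proof (rule measure_eqI)
    fix A assume "A \<in> sets (empirical_measure N x)"
    then have A: "A \<in> sets borel" by simp
    have "(\<Sum>j = 1..N. emeasure (return borel (x j)) A) = (\<Sum>j = 1..N. indicator A (x j))"
      using A by simp
    also have "\<dots> = (\<integral>\<^sup>+ j. indicator A (x j) \<partial>count_space {1..N})"
      by (simp add: nn_integral_count_space_finite)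
    also have "\<dots> = emeasure (distr (count_space {1..N}) borel x) A"
      using A by (subst nn_integral_distr[symmetric, where f="indicator A" and M'=borel]) auto
    finally show "emeasure (empirical_measure N x) A =
        emeasure (scale_measure (ennreal (1 / real N)) (distr (count_space {1..N}) borel x)) A"
      using A by (simp add: emeasure_empirical_measure)
  qed simp
  then show ?thesis
    by (simp add: nn_integral_scale_measure nn_integral_distr nn_integral_count_space_finite)
qed

locale iid_sample = prob_space \<mu> for \<mu> :: "'a::topological_space measure" and N :: nat +
  assumes sets_\<mu> [measurable_cong]: "sets \<mu> = sets borel"
    and N_pos: "N \<ge> 1"
begin

abbreviation sample :: "(nat \<Rightarrow> 'a) measure" where
  "sample \<equiv> \<Pi>\<^sub>M j\<in>{1..N}. \<mu>"

lemma space_\<mu> [simp]: "space \<mu> = UNIV"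
  using sets_eq_imp_space_eq[OF sets_\<mu>] by simp

lemma prob_UNIV [simp]: "prob UNIV = 1"
  using prob_space by simp

sublocale P: prob_space sample
  by (intro prob_space_PiM prob_space_axioms)

lemma measurable_coordinate: "j \<in> {1..N} \<Longrightarrow> (\<lambda>X. X j) \<in> sample \<rightarrow>\<^sub>M borel"
  using measurable_component_singleton[of j "{1..N}" "\<lambda>_. \<mu>"] measurable_cong_sets[OF refl sets_\<mu>] by blast

lemma nn_integral_coordinate:
  assumes "j \<in> {1..N}" and [measurable]: "w \<in> borel_measurable borel"
  shows "(\<integral>\<^sup>+ X. w (X j) \<partial>sample) = (\<integral>\<^sup>+ x. w x \<partial>\<mu>)"
proof -
  have "(\<integral>\<^sup>+ x. w x \<partial>\<mu>) = (\<integral>\<^sup>+ x. w x \<partial>distr sample \<mu> (\<lambda>X. X j))"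
    using distr_coordinate_sample[OF prob_space_axioms assms(1)] by simp
  also have "\<dots> = (\<integral>\<^sup>+ X. w (X j) \<partial>sample)"
    by (rule nn_integral_distr[OF measurable_component_singleton[OF assms(1)]]) measurable
  finally show ?thesis ..
qed

lemma expectation_coordinate:
  fixes w :: "'a \<Rightarrow> real"
  assumes "j \<in> {1..N}" and [measurable]: "w \<in> borel_measurable borel"
  shows "P.expectation (\<lambda>X. w (X j)) = expectation w"
proof -
  have "expectation w = (\<integral> x. w x \<partial>distr sample \<mu> (\<lambda>X. X j))"
    using distr_coordinate_sample[OF prob_space_axioms assms(1)] by simp
  also have "\<dots> = P.expectation (\<lambda>X. w (X j))"
    by (rule integral_distr[OF measurable_component_singleton[OF assms(1)]]) measurable
  finally show ?thesis ..
qed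

text \<open>The empirical measure is unbiased: by linearity its mean integral is the average of
  \<open>N\<close> copies of the integral against \<mu>.\<close>

lemma expectation_nn_integral_empirical:
  assumes [measurable]: "w \<in> borel_measurable borel"
  shows "(\<integral>\<^sup>+ X. (\<integral>\<^sup>+ y. w y \<partial>empirical_measure N X) \<partial>sample) = (\<integral>\<^sup>+ x. w x \<partial>\<mu>)"
proof -
  have [measurable]: "(\<lambda>X. w (X j)) \<in> borel_measurable sample" if "j \<in> {1..N}" for j
    by (rule measurable_compose[OF measurable_coordinate[OF that]]) measurable
  have "(\<integral>\<^sup>+ X. (\<integral>\<^sup>+ y. w y \<partial>empirical_measure N X) \<partial>sample) =
      (\<integral>\<^sup>+ X. ennreal (1 / real N) * (\<Sum>j = 1..N. w (X j)) \<partial>sample)"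
    by (simp add: nn_integral_empirical_measure)
  also have "\<dots> = ennreal (1 / real N) * (\<Sum>j = 1..N. \<integral>\<^sup>+ X. w (X j) \<partial>sample)"
    by (simp add: nn_integral_cmult nn_integral_sum del: atLeastAtMost_iff One_nat_def)
  also have "(\<Sum>j = 1..N. \<integral>\<^sup>+ X. w (X j) \<partial>sample) = of_nat N * (\<integral>\<^sup>+ x. w x \<partial>\<mu>)"
    by (subst sum.cong[OF refl nn_integral_coordinate]) auto
  also have "ennreal (1 / real N) * (of_nat N * (\<integral>\<^sup>+ x. w x \<partial>\<mu>)) = (\<integral>\<^sup>+ x. w x \<partial>\<mu>)"
    using N_pos by (simp add: ennreal_of_nat_eq_real_of_nat mult.assoc[symmetric] flip: ennreal_mult)
  finally show ?thesis .
qed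

lemma measurable_nn_integral_empirical [measurable]:
  assumes [measurable]: "w \<in> borel_measurable borel"
  shows "(\<lambda>X. \<integral>\<^sup>+ y. w y \<partial>empirical_measure N X) \<in> borel_measurable sample"
proof -
  have [measurable]: "(\<lambda>X. w (X j)) \<in> borel_measurable sample" if "j \<in> {1..N}" for j
    by (rule measurable_compose[OF measurable_coordinate[OF that]]) measurable
  show ?thesis
    unfolding nn_integral_empirical_measure[OF assms] by measurable
qed

lemma measurable_empirical_deviation [measurable]:
  assumes [measurable]: "A \<in> sets borel"
  shows "(\<lambda>X. measure (empirical_measure N X) A) \<in> borel_measurable sample"
proof -
  have [measurable]: "(\<lambda>X. indicator A (X j) :: real) \<in> borel_measurable sample" if "j \<in> {1..N}" for j
    by (rule measurable_compose[OF measurable_coordinate[OF that]]) measurable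
  show ?thesis
    unfolding measure_empirical_measure[OF assms] by measurable
qed

text \<open>Triangle inequality and unbiasedness. This is the better bound for cells of mass below
  order \<open>1 / N\<close>, where the variance bound is too weak.\<close>

lemma expectation_deviation_le_mass:
  assumes A[measurable]: "A \<in> sets borel"
  shows "(\<integral>\<^sup>+ X. ennreal \<bar>prob A - measure (empirical_measure N X) A\<bar> \<partial>sample) \<le> ennreal (2 * prob A)"
proof -
  have "(\<integral>\<^sup>+ X. ennreal \<bar>prob A - measure (empirical_measure N X) A\<bar> \<partial>sample) \<le>
      (\<integral>\<^sup>+ X. ennreal (prob A) + (\<integral>\<^sup>+ y. indicator A y \<partial>empirical_measure N X) \<partial>sample)"
  proof (rule nn_integral_mono)
    fix X :: "nat \<Rightarrow> 'a"
    interpret E: prob_space "empirical_measure N X"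
      by (rule prob_space_empirical_measure[OF N_pos])
    show "ennreal \<bar>prob A - measure (empirical_measure N X) A\<bar> \<le>
        ennreal (prob A) + (\<integral>\<^sup>+ y. indicator A y \<partial>empirical_measure N X)"
      using A measure_nonneg[of \<mu> A] measure_nonneg[of "empirical_measure N X" A]
      by (simp add: E.emeasure_eq_measure abs_le_iff flip: ennreal_plus del: measure_nonneg)
  qed
  also have "\<dots> = ennreal (prob A) + (\<integral>\<^sup>+ x. indicator A x \<partial>\<mu>)"
  proof (subst nn_integral_add)
    show "(\<lambda>X. \<integral>\<^sup>+ y. indicator A y \<partial>empirical_measure N X) \<in> borel_measurable sample"
      by measurable
    show "(\<integral>\<^sup>+ X. ennreal (prob A) \<partial>sample) +
        (\<integral>\<^sup>+ X. (\<integral>\<^sup>+ y. indicator A y \<partial>empirical_measure N X) \<partial>sample) =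
        ennreal (prob A) + (\<integral>\<^sup>+ x. indicator A x \<partial>\<mu>)"
      using P.emeasure_space_1 expectation_nn_integral_empirical[OF borel_measurable_indicator[OF A]]
      by (simp del: nn_integral_indicator One_nat_def)
  qed simp
  also have "\<dots> = ennreal (2 * prob A)"
    by (simp add: emeasure_eq_measure flip: ennreal_plus)
  finally show ?thesis .
qed

text \<open>Second moment method: the sum \<open>S\<close> of the \<open>N\<close> centred
  indicators has variance \<open>N\<close> times that of a single one, hence at most
  \<open>N * prob A\<close>, and the first absolute moment is at most the square root of the second
  moment.\<close>

lemma expectation_deviation_le_sqrt:
  assumes A[measurable]: "A \<in> sets borel"
  shows "(\<integral>\<^sup>+ X. ennreal \<bar>prob A - measure (empirical_measure N X) A\<bar> \<partial>sample) \<le> ennreal (sqrt (prob A / N))"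
proof -
  define w where "w x = indicator A x - prob A" for x :: 'a
  have w[measurable]: "w \<in> borel_measurable borel"
    unfolding w_def[abs_def] by measurable
  have w1: "\<bar>w x\<bar> \<le> 1" for x
    unfolding w_def by (auto split: split_indicator)
  have wX[measurable]: "(\<lambda>X. w (X j)) \<in> borel_measurable sample" if "j \<in> {1..N}" for j
    by (rule measurable_compose[OF measurable_coordinate[OF that]]) measurable
  have intA: "integrable \<mu> (\<lambda>x. indicator A x :: real)"
    by (simp add: emeasure_eq_measure)
  have Ew: "expectation w = 0"
    unfolding w_def using intA by (subst Bochner_Integration.integral_diff) (auto simp: prob_space)
  have "expectation (\<lambda>x. (w x)\<^sup>2) = prob A - (prob A)\<^sup>2"
  proof -
    have "(\<lambda>x. (w x)\<^sup>2) = (\<lambda>x. (1 - 2 * prob A) * indicator A x + (prob A)\<^sup>2)"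
      by (auto simp: w_def fun_eq_iff power2_eq_square algebra_simps split: split_indicator)
    then have "expectation (\<lambda>x. (w x)\<^sup>2) = (1 - 2 * prob A) * prob A + (prob A)\<^sup>2"
      using intA by simp
    then show ?thesis
      by (simp add: power2_eq_square algebra_simps)
  qed
  then have Ew2: "expectation (\<lambda>x. (w x)\<^sup>2) \<le> prob A"
    by simp
  have int: "integrable sample (\<lambda>X. w (X j) * w (X k))" if "j \<in> {1..N}" "k \<in> {1..N}" for j k
  proof (rule P.integrable_const_bound[where B=1])
    show "AE X in sample. norm (w (X j) * w (X k)) \<le> 1"
      using w1 by (auto simp: abs_mult intro!: mult_le_one)
  qed (use that in measurable)
  have indep: "P.indep_vars (\<lambda>_. borel) (\<lambda>j X. w (X j)) {1..N}"
    by (rule P.indep_vars_compose2[OF indep_vars_coordinate_sample[OF prob_space_axioms N_pos]]) measurable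
  have cov: "P.expectation (\<lambda>X. w (X j) * w (X k)) = (if j = k then expectation (\<lambda>x. (w x)\<^sup>2) else 0)"
    if jk: "j \<in> {1..N}" "k \<in> {1..N}" for j k
  proof (cases "j = k")
    case True
    then show ?thesis
      using expectation_coordinate[OF jk(1), of "\<lambda>x. (w x)\<^sup>2"] by (simp add: power2_eq_square)
  next
    case False
    have wint: "integrable sample (\<lambda>X. w (X i))" if "i \<in> {1..N}" for i
      by (rule P.integrable_const_bound[where B=1]) (use that w1 in auto)
    \<comment> \<open>Independence factorises the mixed moments, and centring makes them 0.\<close>
    have "P.expectation (\<lambda>X. \<Prod>i\<in>{j, k}. w (X i)) = (\<Prod>i\<in>{j, k}. P.expectation (\<lambda>X. w (X i)))"
      using jk by (intro P.indep_vars_lebesgue_integral P.indep_vars_subset[OF indep])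
        (auto intro: wint simp del: One_nat_def)
    then show ?thesis
      using False Ew expectation_coordinate[OF jk(1) w] by simp
  qed
  define S where "S X = (\<Sum>j = 1..N. w (X j))" for X
  have [measurable]: "S \<in> borel_measurable sample"
    unfolding S_def[abs_def] by measurable
  have S2: "(S X)\<^sup>2 = (\<Sum>j = 1..N. \<Sum>k = 1..N. w (X j) * w (X k))" for X
    by (simp add: S_def power2_eq_square sum_product)
  have "P.expectation (\<lambda>X. (S X)\<^sup>2) = (\<Sum>j = 1..N. P.expectation (\<lambda>X. \<Sum>k = 1..N. w (X j) * w (X k)))"
    unfolding S2 by (intro Bochner_Integration.integral_sum Bochner_Integration.integrable_sum int)
  also have "\<dots> = (\<Sum>j = 1..N. \<Sum>k = 1..N. P.expectation (\<lambda>X. w (X j) * w (X k)))"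
    by (intro sum.cong refl Bochner_Integration.integral_sum int)
  also have "\<dots> = (\<Sum>j = 1..N. \<Sum>k = 1..N. (if j = k then expectation (\<lambda>x. (w x)\<^sup>2) else 0))"
    by (intro sum.cong refl cov)
  also have "\<dots> = N * expectation (\<lambda>x. (w x)\<^sup>2)"
    by simp
  finally have ES2: "P.expectation (\<lambda>X. (S X)\<^sup>2) \<le> N * prob A"
    using Ew2 by (simp add: mult_left_mono)
  have intS2: "integrable sample (\<lambda>X. (S X)\<^sup>2)"
    unfolding S2 by (intro Bochner_Integration.integrable_sum int)
  have intS: "integrable sample (\<lambda>X. \<bar>S X\<bar>)"
  proof (rule P.integrable_const_bound[where B=N])
    show "AE X in sample. norm \<bar>S X\<bar> \<le> real N"
    proof (rule AE_I2)
      fix X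
      have "\<bar>S X\<bar> \<le> (\<Sum>j = 1..N. \<bar>w (X j)\<bar>)"
        unfolding S_def by (rule sum_abs)
      also have "\<dots> \<le> N"
        using sum_bounded_above[of "{1..N}" "\<lambda>j. \<bar>w (X j)\<bar>" 1] w1 by simp
      finally show "norm \<bar>S X\<bar> \<le> real N" by simp
    qed
  qed measurable
  \<comment> \<open>Nonnegativity of the variance of \<open>|S|\<close> serves as the Cauchy-Schwarz
    inequality.\<close>
  have "0 \<le> P.variance (\<lambda>X. \<bar>S X\<bar>)"
    by (rule P.variance_positive)
  also have "\<dots> = P.expectation (\<lambda>X. (S X)\<^sup>2) - (P.expectation (\<lambda>X. \<bar>S X\<bar>))\<^sup>2"
    using intS intS2 by (subst P.variance_eq) auto
  finally have ES: "P.expectation (\<lambda>X. \<bar>S X\<bar>) \<le> sqrt (N * prob A)"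
    using ES2 by (intro real_le_rsqrt) simp
  have dev: "\<bar>prob A - measure (empirical_measure N X) A\<bar> = \<bar>S X\<bar> / N" for X
  proof -
    have "prob A - measure (empirical_measure N X) A = - S X / N"
      using N_pos by (simp add: measure_empirical_measure[OF A] S_def w_def sum_subtractf field_simps)
    then show ?thesis by simp
  qed
  have "(\<integral>\<^sup>+ X. ennreal \<bar>prob A - measure (empirical_measure N X) A\<bar> \<partial>sample) =
      ennreal (P.expectation (\<lambda>X. \<bar>S X\<bar>) / N)"
    unfolding dev using intS by (subst nn_integral_eq_integral) auto
  also have "\<dots> \<le> ennreal (sqrt (N * prob A) / N)"
    using ES by (intro ennreal_leI divide_right_mono) auto
  also have "sqrt (N * prob A) / N = sqrt (prob A / N)"
    using N_pos by (simp add: real_sqrt_mult real_sqrt_divide field_simps)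
  finally show ?thesis .
qed

end

subsection \<open>Dyadic cells\<close>

text \<open>Used to integrate sums over cells with respect to the sample; countability of the index
  type supplies joint measurability.\<close>

lemma borel_measurable_nn_integral_count_space:
  fixes f :: "'c::countable \<Rightarrow> 'a \<Rightarrow> ennreal"
  assumes "\<And>i. f i \<in> borel_measurable M"
  shows "(\<lambda>x. \<integral>\<^sup>+ i. f i x \<partial>count_space UNIV) \<in> borel_measurable M"
proof -
  interpret sigma_finite_measure "count_space (UNIV :: 'c set)"
    by (rule sigma_finite_measure_count_space_countable) simp
  have "(\<lambda>z. f (snd z) (fst z)) \<in> borel_measurable (M \<Otimes>\<^sub>M count_space UNIV)"
    by (rule measurable_compose_countable) (auto intro: measurable_compose[OF measurable_fst] assms)
  then show ?thesis
    by (intro borel_measurable_nn_integral) (simp add: case_prod_beta)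
qed

text \<open>For \<open>r > 0\<close>, shell 0 is the whole closed ball of radius \<open>r\<close>;
  only the later shells are annuli.\<close>

definition shell :: "real \<Rightarrow> 'a::real_normed_vector \<Rightarrow> nat" where
  "shell r x = (LEAST n. norm x \<le> 2 ^ n * r)"

lemma norm_le_shell:
  assumes "r > 0"
  shows "norm x \<le> 2 ^ shell r x * r"
proof -
  obtain n where "norm x / r < 2 ^ n"
    using real_arch_pow[of 2 "norm x / r"] by auto
  then have "norm x \<le> 2 ^ n * r"
    using assms by (simp add: field_simps)
  then show ?thesis
    unfolding shell_def by (rule LeastI)
qed

lemma norm_gt_shell: "shell r x = Suc n \<Longrightarrow> 2 ^ n * r < norm x"
  using not_less_Least[of n "\<lambda>n. norm x \<le> 2 ^ n * r"] by (simp add: shell_def)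

lemma measurable_shell [measurable]:
  "shell r \<in> borel \<rightarrow>\<^sub>M count_space (UNIV :: nat set)"
  unfolding shell_def[abs_def] by measurable

text \<open>The mesh \<open>2 ^ n * r / 2 ^ l\<close> is proportional to the radius of shell
  \<open>n\<close>, so the number of cells in a shell is bounded in terms of \<open>l\<close> and
  the dimension alone. Recording the shell in the index keeps cells of different shells
  apart.\<close>

definition cell :: "real \<Rightarrow> nat \<Rightarrow> real ^ 'n \<Rightarrow> nat \<times> (int ^ 'n)" where
  "cell r l x = (shell r x, \<chi> i. \<lfloor>x $ i * 2 ^ l / (2 ^ shell r x * r)\<rfloor>)"

lemma fst_cell [simp]: "fst (cell r l x) = shell r x"
  by (simp add: cell_def)

lemma measurable_cell [measurable]:
  "(cell r l :: real ^ 'n \<Rightarrow> _) \<in> borel \<rightarrow>\<^sub>M count_space UNIV"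
proof -
  have "(cell r l -` {(n, z)} :: (real ^ 'n) set) =
      {x \<in> space borel. shell r x = n \<and> (\<forall>i\<in>UNIV. \<lfloor>x $ i * 2 ^ l / (2 ^ shell r x * r)\<rfloor> = z $ i)}" for n z
    by (auto simp: cell_def vec_eq_iff)
  moreover have meas: "{x \<in> space borel. shell r x = n \<and> (\<forall>i\<in>UNIV. \<lfloor>x $ i * 2 ^ l / (2 ^ shell r x * r)\<rfloor> = z $ i)} \<in>
      sets (borel :: (real ^ 'n) measure)" for n z
    by measurable
  ultimately have "cell r l -` {i} \<in> sets (borel :: (real ^ 'n) measure)" for i
    by (cases i) simp
  then show ?thesis
    by (simp add: measurable_count_space_eq2_countable)
qed

text \<open>Halving the mesh refines the grid, since the floor of \<open>u\<close> is determined by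
  the floor of \<open>2 * u\<close>.\<close>

lemma cell_nested:
  assumes "cell r (Suc l) x = cell r (Suc l) y"
  shows "cell r l x = cell r l y"
proof -
  have s: "shell r x = shell r y"
    using assms by (simp add: cell_def)
  have half: "\<lfloor>u\<rfloor> = \<lfloor>2 * u\<rfloor> div 2" for u :: real
    using floor_divide_real_eq_div[of 2 "2 * u"] by simp
  have "\<lfloor>x $ i * 2 ^ l / (2 ^ shell r x * r)\<rfloor> = \<lfloor>y $ i * 2 ^ l / (2 ^ shell r y * r)\<rfloor>" for i
  proof -
    have "\<lfloor>2 * (x $ i * 2 ^ l / (2 ^ shell r x * r))\<rfloor> = \<lfloor>2 * (y $ i * 2 ^ l / (2 ^ shell r y * r))\<rfloor>"
      using assms by (auto simp: cell_def vec_eq_iff mult_ac)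
    then show ?thesis
      by (metis half)
  qed
  then show ?thesis
    using s by (simp add: cell_def)
qed

text \<open>Within a cell each coordinate varies by at most the mesh, and the Euclidean norm is
  bounded by the sum of the absolute coordinates; hence the factor \<open>CARD('n)\<close>.\<close>

lemma cell_diameter:
  fixes x y :: "real ^ 'n"
  assumes "cell r l x = cell r l y" "r > 0"
  shows "norm (x - y) \<le> CARD('n) * (2 ^ shell r x * r / 2 ^ l)"
proof -
  define h where "h = 2 ^ shell r x * r / 2 ^ l"
  have "h > 0"
    using assms(2) by (simp add: h_def)
  have "\<bar>(x - y) $ i\<bar> \<le> h" for i
  proof -
    have "\<lfloor>x $ i / h\<rfloor> = \<lfloor>y $ i / h\<rfloor>"
      using assms(1) by (auto simp: cell_def vec_eq_iff h_def)
    then have "\<bar>x $ i / h - y $ i / h\<bar> < 1"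
      by linarith
    then show ?thesis
      using \<open>h > 0\<close> by (simp add: abs_divide flip: diff_divide_distrib)
  qed
  then have "(\<Sum>i\<in>UNIV. \<bar>(x - y) $ i\<bar>) \<le> CARD('n) * h"
    using sum_bounded_above[of UNIV "\<lambda>i. \<bar>(x - y) $ i\<bar>" h] by simp
  then show ?thesis
    using norm_le_l1_cart[of "x - y"] by (simp add: h_def)
qed

text \<open>A finite box of integer vectors containing every index that occurs. Both endpoints
  belong to it, because a coordinate may equal plus or minus the shell radius.\<close>

definition cell_indices :: "nat \<Rightarrow> (int ^ 'n) set" where
  "cell_indices l = vec_lambda ` (UNIV \<rightarrow>\<^sub>E {- (2 ^ l)..2 ^ l})"

lemma finite_cell_indices [simp]: "finite (cell_indices l)"
  unfolding cell_indices_def by (intro finite_imageI finite_PiE) auto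

lemma card_cell_indices: "card (cell_indices l :: (int ^ 'n) set) \<le> (3 * 2 ^ l) ^ CARD('n)"
proof -
  have "card (cell_indices l :: (int ^ 'n) set) \<le> card ((UNIV :: 'n set) \<rightarrow>\<^sub>E {- (2 ^ l :: int)..2 ^ l})"
    unfolding cell_indices_def by (intro card_image_le finite_PiE) auto
  also have "\<dots> = nat (1 + 2 * 2 ^ l) ^ CARD('n)"
    by (simp add: card_PiE add.commute)
  \<comment> \<open>Each coordinate takes \<open>2 * 2 ^ l + 1\<close> values, at most
    \<open>3 * 2 ^ l\<close> because \<open>1 \<le> 2 ^ l\<close>.\<close>
  also have "\<dots> \<le> (3 * 2 ^ l) ^ CARD('n)"
  proof (rule power_mono)
    have "(1::int) \<le> 2 ^ l" by simp
    then have "nat (1 + 2 * 2 ^ l) \<le> nat (3 * 2 ^ l)" by linarith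
    then show "nat (1 + 2 * 2 ^ l) \<le> 3 * 2 ^ l"
      by (simp add: nat_mult_distrib nat_power_eq)
  qed simp
  finally show ?thesis .
qed

lemma cell_in_indices:
  fixes x :: "real ^ 'n"
  assumes "r > 0"
  shows "snd (cell r l x) \<in> cell_indices l"
proof -
  have "\<lfloor>x $ i * 2 ^ l / (2 ^ shell r x * r)\<rfloor> \<in> {- (2 ^ l)..2 ^ l}" for i
  proof -
    define u where "u = x $ i / (2 ^ shell r x * r)"
    have "\<bar>x $ i\<bar> \<le> 2 ^ shell r x * r"
      using component_le_norm_cart[of x i] norm_le_shell[OF assms, of x] by linarith
    then have "\<bar>u\<bar> \<le> 1"
      using assms by (simp add: u_def abs_divide)
    then have "\<bar>u * 2 ^ l\<bar> \<le> 2 ^ l"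
      by (simp add: abs_mult mult_left_le_one_le)
    then have "- (2 ^ l) \<le> u * 2 ^ l" "u * 2 ^ l \<le> 2 ^ l"
      by (simp_all add: abs_le_iff)
    then have "\<lfloor>- (2 ^ l) :: real\<rfloor> \<le> \<lfloor>u * 2 ^ l\<rfloor>" "\<lfloor>u * 2 ^ l\<rfloor> \<le> \<lfloor>2 ^ l :: real\<rfloor>"
      by (simp_all only: floor_mono)
    moreover have "\<lfloor>- (2 ^ l) :: real\<rfloor> = - (2 ^ l)" "\<lfloor>2 ^ l :: real\<rfloor> = 2 ^ l"
      using floor_of_int[of "- (2 ^ l)", where 'a=real] floor_of_int[of "2 ^ l", where 'a=real] by simp_all
    ultimately have "- (2 ^ l) \<le> \<lfloor>u * 2 ^ l\<rfloor>" "\<lfloor>u * 2 ^ l\<rfloor> \<le> 2 ^ l"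
      by simp_all
    then show ?thesis
      by (simp add: u_def)
  qed
  then show ?thesis
    unfolding cell_indices_def cell_def
    by (auto intro!: image_eqI[of _ _ "\<lambda>i. \<lfloor>x $ i * 2 ^ l / (2 ^ shell r x * r)\<rfloor>"])
qed

text \<open>Markov's inequality on the shell, where the norm exceeds \<open>2 ^ (n - 1) * r\<close>
  if \<open>n > 0\<close>. The factor \<open>2 powr q\<close> compensates for the shift from
  \<open>n - 1\<close> to \<open>n\<close> and makes the bound for shell 0 at least 1, hence
  trivial.\<close>

lemma shell_mass:
  fixes q r :: real and \<mu> :: "'a::real_normed_vector measure"
  assumes "prob_space \<mu>" and [measurable_cong]: "sets \<mu> = sets borel" and "r > 0" "q > 0"
    and moment: "(\<integral>\<^sup>+ x. ennreal (norm x powr q) \<partial>\<mu>) \<le> ennreal (r powr q)"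
  shows "measure \<mu> (shell r -` {n}) \<le> 2 powr q * 2 powr (- q * n)"
proof -
  interpret prob_space \<mu> by fact
  show ?thesis
  proof (cases n)
    case 0
    have "(1::real) \<le> 2 powr q"
      using assms by (intro ge_one_powr_ge_zero) auto
    then show ?thesis
      using 0 order_trans[OF prob_le_1[of "shell r -` {n}"]] by simp
  next
    case (Suc m)
    have [measurable]: "shell r -` {n} \<in> sets borel"
      by (rule measurable_sets_borel[OF measurable_shell]) simp
    have "ennreal ((2 ^ m * r) powr q * prob (shell r -` {n})) =
        (\<integral>\<^sup>+ x. ennreal ((2 ^ m * r) powr q) * indicator (shell r -` {n}) x \<partial>\<mu>)"
      by (simp add: nn_integral_cmult_indicator emeasure_eq_measure ennreal_mult)
    also have "\<dots> \<le> (\<integral>\<^sup>+ x. ennreal (norm x powr q) \<partial>\<mu>)"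
    proof (intro nn_integral_mono)
      fix x
      have "(2 ^ m * r) powr q \<le> norm x powr q" if "shell r x = n"
        using norm_gt_shell[of r x m] that Suc assms by (intro powr_mono2) auto
      then show "ennreal ((2 ^ m * r) powr q) * indicator (shell r -` {n}) x \<le> ennreal (norm x powr q)"
        by (auto split: split_indicator intro!: ennreal_leI)
    qed
    also note moment
    finally have "(2 ^ m * r) powr q * prob (shell r -` {n}) \<le> r powr q"
      by simp
    then have "2 powr (q * m) * prob (shell r -` {n}) \<le> 1"
      using assms by (simp add: powr_mult powr_powr mult.commute flip: powr_realpow)
    then have "prob (shell r -` {n}) \<le> 2 powr (- (q * m))"
      by (simp add: powr_minus field_simps)
    also have "\<dots> = 2 powr q * 2 powr (- q * n)"
      using Suc by (simp add: algebra_simps flip: powr_add)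
    finally show ?thesis .
  qed
qed

lemma nn_integral_shell_le:
  fixes q r :: real and \<phi> :: "nat \<Rightarrow> ennreal"
  assumes "prob_space \<mu>" "sets \<mu> = sets borel" "\<And>n. measure \<mu> (shell r -` {n}) \<le> \<epsilon> n"
  shows "(\<integral>\<^sup>+ x. \<phi> (shell r x) \<partial>\<mu>) \<le> (\<integral>\<^sup>+ n. \<phi> n * ennreal (\<epsilon> n) \<partial>count_space UNIV)"
proof -
  interpret prob_space \<mu> by fact
  have [measurable]: "shell r -` {n} \<in> sets \<mu>" for n
    using measurable_sets_borel[OF measurable_shell, of "{n}"] assms by simp
  have "(\<integral>\<^sup>+ x. \<phi> (shell r x) * 1 \<partial>\<mu>) =
      (\<integral>\<^sup>+ n. \<phi> n * (\<integral>\<^sup>+ x. 1 * indicator (shell r -` {n}) x \<partial>\<mu>) \<partial>count_space UNIV)"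
    by (rule nn_integral_cells) (auto simp: assms(2))
  also have "\<dots> \<le> (\<integral>\<^sup>+ n. \<phi> n * ennreal (\<epsilon> n) \<partial>count_space UNIV)"
    by (intro nn_integral_mono mult_left_mono)
      (auto simp: emeasure_eq_measure intro!: ennreal_leI assms(3))
  finally show ?thesis by simp
qed

text \<open>The two deviation bounds are summed over the cells of one shell: the masses add up to at
  most \<open>\<epsilon> n\<close>, and the square roots are handled by Cauchy-Schwarz against the
  number of cells. The minimum is taken after this summation, separately for each shell.\<close>

lemma level_deviation:
  fixes \<mu> :: "(real ^ 'n) measure" and \<phi> :: "nat \<Rightarrow> ennreal"
  assumes "iid_sample \<mu> N" and r: "r > 0"
    and \<epsilon>: "\<And>n. measure \<mu> (shell r -` {n}) \<le> \<epsilon> n"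
  shows "(\<integral>\<^sup>+ i. \<phi> (fst i) * (\<integral>\<^sup>+ X. ennreal \<bar>measure \<mu> (cell r l -` {i}) -
        measure (empirical_measure N X) (cell r l -` {i})\<bar> \<partial>(\<Pi>\<^sub>M j\<in>{1..N}. \<mu>)) \<partial>count_space UNIV) \<le>
    (\<integral>\<^sup>+ n. \<phi> n * ennreal (min (2 * \<epsilon> n) (sqrt ((3 * 2 ^ l) ^ CARD('n) * \<epsilon> n / N))) \<partial>count_space UNIV)"
proof -
  interpret iid_sample \<mu> N by fact
  let ?Z = "cell_indices l :: (int ^ 'n) set"
  let ?A = "\<lambda>n z. cell r l -` {(n, z)} :: (real ^ 'n) set"
  define dev where "dev i = (\<integral>\<^sup>+ X. ennreal \<bar>prob (cell r l -` {i}) -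
        measure (empirical_measure N X) (cell r l -` {i})\<bar> \<partial>sample)" for i
  have A: "?A n z \<in> sets borel" for n z
    by (rule measurable_sets_borel[OF measurable_cell]) simp
  have dev1: "dev (n, z) \<le> ennreal (2 * prob (?A n z))"
    and dev2: "dev (n, z) \<le> ennreal (sqrt (prob (?A n z) / N))" for n z
    unfolding dev_def by (rule expectation_deviation_le_mass[OF A] expectation_deviation_le_sqrt[OF A])+
  \<comment> \<open>Indices outside the box belong to empty cells, so the sum over \<open>z\<close>
    is finite.\<close>
  have empty: "?A n z = {}" if "z \<notin> ?Z" for n z
  proof -
    have "cell r l x \<noteq> (n, z)" for x
      using cell_in_indices[OF r, of l x] that by auto
    then show ?thesis by auto
  qed
  have mass: "(\<Sum>z\<in>?Z. prob (?A n z)) \<le> \<epsilon> n" for n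
  proof -
    have "(\<Sum>z\<in>?Z. prob (?A n z)) = prob (\<Union>z\<in>?Z. ?A n z)"
      using A by (intro finite_measure_finite_Union[symmetric]) (auto simp: disjoint_family_on_def sets_\<mu>)
    also have "(\<Union>z\<in>?Z. ?A n z) = shell r -` {n}"
    proof (intro set_eqI iffI)
      fix x :: "real ^ 'n" assume "x \<in> shell r -` {n}"
      then have "cell r l x = (n, snd (cell r l x))"
        by (simp add: cell_def)
      then show "x \<in> (\<Union>z\<in>?Z. ?A n z)"
        using cell_in_indices[OF r, of l x] by blast
    qed (auto simp: cell_def)
    finally show ?thesis
      using \<epsilon>[of n] by simp
  qed
  have sum: "(\<Sum>z\<in>?Z. dev (n, z)) \<le> ennreal (min (2 * \<epsilon> n) (sqrt ((3 * 2 ^ l) ^ CARD('n) * \<epsilon> n / N)))" for n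
  proof -
    have "(\<Sum>z\<in>?Z. dev (n, z)) \<le> ennreal (\<Sum>z\<in>?Z. 2 * prob (?A n z))"
      by (subst sum_ennreal[symmetric]) (simp, intro sum_mono dev1)
    also have "(\<Sum>z\<in>?Z. 2 * prob (?A n z)) \<le> 2 * \<epsilon> n"
      using mass[of n] by (simp flip: sum_distrib_left)
    finally have 1: "(\<Sum>z\<in>?Z. dev (n, z)) \<le> ennreal (2 * \<epsilon> n)"
      by (simp add: ennreal_leI)
    have "(\<Sum>z\<in>?Z. sqrt (prob (?A n z) / N))\<^sup>2 \<le> card ?Z * (\<Sum>z\<in>?Z. (sqrt (prob (?A n z) / N))\<^sup>2)"
      using Cauchy_Schwarz_ineq_sum[of "\<lambda>_. 1" "\<lambda>z. sqrt (prob (?A n z) / N)" ?Z] by simp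
    also have "\<dots> = card ?Z * ((\<Sum>z\<in>?Z. prob (?A n z)) / N)"
      by (simp add: sum_divide_distrib)
    also have "\<dots> \<le> (3 * 2 ^ l) ^ CARD('n) * (\<epsilon> n / N)"
      using mass[of n] card_cell_indices[where 'n='n, of l]
      by (intro mult_mono divide_right_mono) (auto intro!: sum_nonneg divide_nonneg_nonneg simp flip: of_nat_le_iff[where 'a=real])
    finally have "(\<Sum>z\<in>?Z. sqrt (prob (?A n z) / N)) \<le> sqrt ((3 * 2 ^ l) ^ CARD('n) * \<epsilon> n / N)"
      by (intro real_le_rsqrt) simp
    moreover have "(\<Sum>z\<in>?Z. dev (n, z)) \<le> ennreal (\<Sum>z\<in>?Z. sqrt (prob (?A n z) / N))"
      by (subst sum_ennreal[symmetric]) (simp, intro sum_mono dev2)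
    ultimately have 2: "(\<Sum>z\<in>?Z. dev (n, z)) \<le> ennreal (sqrt ((3 * 2 ^ l) ^ CARD('n) * \<epsilon> n / N))"
      by (meson ennreal_leI order_trans)
    from 1 2 show ?thesis
      by (auto simp: min_def)
  qed
  have "(\<integral>\<^sup>+ i. \<phi> (fst i) * dev i \<partial>count_space UNIV) =
      (\<integral>\<^sup>+ n. (\<integral>\<^sup>+ z. \<phi> n * dev (n, z) \<partial>count_space UNIV) \<partial>count_space UNIV)"
    by (subst nn_integral_fst_count_space[symmetric]) simp
  also have "\<dots> = (\<integral>\<^sup>+ n. \<phi> n * (\<Sum>z\<in>?Z. dev (n, z)) \<partial>count_space UNIV)"
  proof (intro nn_integral_cong)
    fix n
    have "(\<integral>\<^sup>+ z. \<phi> n * dev (n, z) \<partial>count_space UNIV) = (\<Sum>z\<in>?Z. \<phi> n * dev (n, z))"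
    proof (rule nn_integral_count_space')
      show "\<phi> n * dev (n, z) = 0" if "z \<notin> ?Z" for z
        unfolding dev_def empty[OF that] by simp
    qed auto
    then show "(\<integral>\<^sup>+ z. \<phi> n * dev (n, z) \<partial>count_space UNIV) = \<phi> n * (\<Sum>z\<in>?Z. dev (n, z))"
      by (simp add: sum_distrib_left)
  qed
  also have "\<dots> \<le> (\<integral>\<^sup>+ n. \<phi> n * ennreal (min (2 * \<epsilon> n) (sqrt ((3 * 2 ^ l) ^ CARD('n) * \<epsilon> n / N))) \<partial>count_space UNIV)"
    by (intro nn_integral_mono mult_left_mono sum) simp
  finally show ?thesis
    unfolding dev_def .
qed

subsection \<open>Expected transport cost\<close>

lemma is_norm_le_norm:
  fixes nrm :: "'a::euclidean_space \<Rightarrow> real"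
  assumes "is_norm nrm"
  obtains C where "C > 0" "\<And>x. nrm x \<le> C * norm x"
proof
  define C where "C = (\<Sum>b\<in>Basis. nrm (b :: 'a)) + 1"
  have nn: "nrm x \<ge> 0" and sc: "nrm (c *\<^sub>R x) = \<bar>c\<bar> * nrm x" and tri: "nrm (x + y) \<le> nrm x + nrm y"
    and zero: "nrm 0 = 0" for x y c
    using assms by (auto simp: is_norm_def)
  show "C > 0"
    unfolding C_def using nn by (intro add_nonneg_pos sum_nonneg) auto
  have sum: "nrm (\<Sum>b\<in>B. f b) \<le> (\<Sum>b\<in>B. nrm (f b))" if "finite B" for B and f :: "'a \<Rightarrow> 'a"
    using that by (induction) (auto simp: zero intro: order_trans[OF tri])
  show "nrm x \<le> C * norm x" for x
  proof -
    have "nrm x = nrm (\<Sum>b\<in>Basis. (x \<bullet> b) *\<^sub>R b)"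
      by (simp add: euclidean_representation)
    also have "\<dots> \<le> (\<Sum>b\<in>Basis. nrm ((x \<bullet> b) *\<^sub>R b))"
      by (rule sum) simp
    also have "\<dots> \<le> (\<Sum>b\<in>Basis. norm x * nrm b)"
      by (intro sum_mono) (auto simp: sc nn Basis_le_norm intro: mult_right_mono)
    also have "\<dots> \<le> C * norm x"
      unfolding C_def by (simp add: sum_distrib_left[symmetric] algebra_simps)
    finally show ?thesis .
  qed
qed

lemma is_norm_continuous_on:
  fixes nrm :: "'a::euclidean_space \<Rightarrow> real"
  assumes "is_norm nrm"
  shows "continuous_on S nrm"
proof -
  obtain C where C: "C > 0" "\<And>x. nrm x \<le> C * norm x"
    using is_norm_le_norm[OF assms] by blast
  have "dist (nrm x) (nrm y) \<le> C * dist x y" for x y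
  proof -
    have tri: "nrm (u + v) \<le> nrm u + nrm v" for u v
      using assms by (auto simp: is_norm_def)
    show ?thesis
      using tri[of "x - y" y] tri[of "y - x" x] C(2)[of "x - y"] C(2)[of "y - x"]
      by (simp add: dist_real_def dist_norm norm_minus_commute abs_le_iff)
  qed
  then have "C-lipschitz_on S nrm"
    using C(1) by (intro lipschitz_onI) auto
  then show ?thesis
    by (rule lipschitz_on_continuous_on)
qed

text \<open>\<open>nrm\<close> attains a positive minimum on the compact Euclidean unit sphere;
  homogeneity extends the comparison to all vectors.\<close>

lemma is_norm_ge_norm:
  fixes nrm :: "'a::euclidean_space \<Rightarrow> real"
  assumes "is_norm nrm"
  obtains C where "C > 0" "\<And>x. norm x \<le> C * nrm x"
proof -
  have nn: "nrm x \<ge> 0" and sc: "nrm (c *\<^sub>R x) = \<bar>c\<bar> * nrm x" and pos: "nrm x = 0 \<longleftrightarrow> x = 0" for x c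
    using assms by (auto simp: is_norm_def)
  have "sphere (0 :: 'a) 1 \<noteq> {}"
    by simp
  then obtain u where u: "u \<in> sphere 0 1" "\<And>x. x \<in> sphere 0 1 \<Longrightarrow> nrm u \<le> nrm x"
    using continuous_attains_inf[OF compact_sphere _ is_norm_continuous_on[OF assms]] by blast
  have "nrm u > 0"
    using u(1) nn[of u] pos[of u] by (cases "u = 0") auto
  show ?thesis
  proof
    show "1 / nrm u > 0"
      using \<open>nrm u > 0\<close> by simp
    show "norm x \<le> 1 / nrm u * nrm x" for x
    proof (cases "x = 0")
      case False
      have "nrm u \<le> nrm ((1 / norm x) *\<^sub>R x)"
        using False by (intro u(2)) simp
      then show ?thesis
        using False \<open>nrm u > 0\<close> by (simp add: sc field_simps)
    qed (simp add: nn)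
  qed
qed

lemma ennreal_powr_mono: "x \<le> y \<Longrightarrow> a \<ge> 0 \<Longrightarrow> ennreal_powr x a \<le> ennreal_powr y a"
  unfolding ennreal_powr_def by (auto simp: top_unique intro!: ennreal_leI powr_mono2 enn2real_mono less_top[THEN iffD1])

lemma ennreal_powr_inverse: "p > 0 \<Longrightarrow> ennreal_powr (ennreal_powr x (1 / p)) p = x"
  by (cases x) (auto simp: ennreal_powr_def powr_powr)

lemma wasserstein_powr_le:
  assumes "\<xi> \<in> couplings \<mu> \<nu>" "p > 0"
  shows "ennreal_powr (wasserstein nrm p \<mu> \<nu>) p \<le> (\<integral>\<^sup>+ z. ennreal (nrm (fst z - snd z) powr p) \<partial>\<xi>)"
proof -
  have "wasserstein nrm p \<mu> \<nu> \<le> ennreal_powr (\<integral>\<^sup>+ (x, y). ennreal (nrm (x - y) powr p) \<partial>\<xi>) (1 / p)"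
    unfolding wasserstein_def by (rule INF_lower) fact
  then have "ennreal_powr (wasserstein nrm p \<mu> \<nu>) p \<le>
      ennreal_powr (ennreal_powr (\<integral>\<^sup>+ (x, y). ennreal (nrm (x - y) powr p) \<partial>\<xi>) (1 / p)) p"
    using assms by (intro ennreal_powr_mono) auto
  then show ?thesis
    using assms by (simp add: ennreal_powr_inverse case_prod_beta')
qed

text \<open>For \<open>k \<le> L\<close>, \<open>D k n\<close> bounds the \<open>p\<close>th power
  of the \<open>nrm\<close>-diameter of a cell of depth \<open>L - k\<close> in shell
  \<open>n\<close>. Matching in the finest cells is charged once to \<mu> and once, in expectation,
  to the empirical measure, hence the factor 2. A discrepancy at depth \<open>L - k\<close> is paid
  for one level higher, at price \<open>D (Suc k)\<close>; for \<open>k = L\<close> this is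
  transport between shells.\<close>

lemma expected_cost:
  fixes \<mu> :: "(real ^ 'n) measure" and C r p :: real and L :: nat
  assumes "iid_sample \<mu> N" and r: "r > 0" and p: "p > 0" and nrm: "is_norm nrm"
    and C: "C > 0" "\<And>x. nrm x \<le> C * norm x"
    and \<epsilon>: "\<And>n. measure \<mu> (shell r -` {n}) \<le> \<epsilon> n"
  defines "D \<equiv> \<lambda>k n. (C * CARD('n) * (2 ^ n * r) * 2 ^ k / 2 ^ L) powr p"
  shows "(\<integral>\<^sup>+ X. ennreal_powr (wasserstein nrm p \<mu> (empirical_measure N X)) p \<partial>(\<Pi>\<^sub>M j\<in>{1..N}. \<mu>)) \<le>
    2 * (\<integral>\<^sup>+ n. ennreal (D 0 n * \<epsilon> n) \<partial>count_space UNIV) +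
    (\<Sum>k\<le>L. \<integral>\<^sup>+ n. ennreal (D (Suc k) n *
       min (2 * \<epsilon> n) (sqrt ((3 * 2 ^ (L - k)) ^ CARD('n) * \<epsilon> n / N))) \<partial>count_space UNIV)"
proof -
  interpret iid_sample \<mu> N by fact
  have nn: "nrm x \<ge> 0" and tri: "nrm (x + y) \<le> nrm x + nrm y" for x y
    using nrm by (auto simp: is_norm_def)
  have [measurable]: "nrm \<in> borel_measurable borel"
    by (intro borel_measurable_continuous_onI is_norm_continuous_on nrm)
  \<comment> \<open>The index is reversed: \<open>k\<close> counts upwards from the finest level,
    and past \<open>L\<close> a single cell remains, which makes the final matching
    complete.\<close>
  define g :: "nat \<Rightarrow> real ^ 'n \<Rightarrow> nat \<times> (int ^ 'n)" where
    "g k = (if k \<le> L then cell r (L - k) else (\<lambda>_. (0, 0)))" for k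
  define c where "c z = ennreal (nrm (fst z - snd z) powr p)" for z :: "(real ^ 'n) \<times> (real ^ 'n)"
  define w where "w x = ennreal (D 0 (shell r x))" for x :: "real ^ 'n"
  define W where "W k i = ennreal (D (Suc k) (fst i))" for k and i :: "nat \<times> (int ^ 'n)"
  define dev where "dev k i X = ennreal \<bar>measure \<mu> (g k -` {i}) - measure (empirical_measure N X) (g k -` {i})\<bar>" for k i X
  have g[measurable]: "g k \<in> borel \<rightarrow>\<^sub>M count_space UNIV" for k
    unfolding g_def by (cases "k \<le> L") simp_all
  have gA[measurable]: "g k -` {i} \<in> sets borel" for k i
    by (rule measurable_sets_borel[OF g]) simp
  have cm[measurable]: "c \<in> borel_measurable (borel \<Otimes>\<^sub>M borel)"
    unfolding c_def[abs_def] by measurable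
  have wm[measurable]: "w \<in> borel_measurable borel"
    unfolding w_def[abs_def] by measurable
  have nested: "g (Suc k) x = g (Suc k) y" if "g k x = g k y" for k x y
  proof (cases "Suc k \<le> L")
    case True
    then have "L - k = Suc (L - Suc k)" by simp
    then show ?thesis
      using cell_nested[of r "L - Suc k" x y] that True by (simp add: g_def)
  qed (simp add: g_def)
  have trivial: "g (Suc L) x = g (Suc L) y" for x y
    by (simp add: g_def)
  have cell_cost: "c (x, y) \<le> ennreal (D k (shell r x))"
    if "k \<le> L" "cell r (L - k) x = cell r (L - k) y" for k x y
  proof -
    have "nrm (x - y) \<le> C * (CARD('n) * (2 ^ shell r x * r / 2 ^ (L - k)))"
      using C(1) by (intro order_trans[OF C(2)] mult_left_mono cell_diameter that(2) r) simp
    also have "\<dots> = C * CARD('n) * (2 ^ shell r x * r) * 2 ^ k / 2 ^ L"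
      using that(1) by (simp add: power_diff field_simps)
    finally show ?thesis
      unfolding c_def D_def using p nn by (auto intro!: ennreal_leI powr_mono2)
  qed
  \<comment> \<open>Both points share a shell, so one of the two weights alone suffices.\<close>
  have c0: "c (x, y) \<le> w x + w y" if "g 0 x = g 0 y" for x y
    using cell_cost[of 0 x y] that by (simp add: g_def w_def add_increasing2)
  have cW: "c (x, y) \<le> W k (g k x) + W k (g k y)" if "k < Suc L" "g (Suc k) x = g (Suc k) y" for k x y
  proof (cases "k < L")
    case True
    then have "cell r (L - Suc k) x = cell r (L - Suc k) y"
      using that by (simp add: g_def)
    with True have "c (x, y) \<le> ennreal (D (Suc k) (shell r x))"
      by (intro cell_cost) auto
    then show ?thesis
      using True by (simp add: g_def W_def add_increasing2)
  next
    case False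
    then have k: "k = L"
      using that by simp
    \<comment> \<open>In the last step points of different shells may be matched. Their distance is
      at most twice the radius of the larger shell, and the factor \<open>CARD('n)\<close> brings
      the bound into the shape of \<open>D (Suc L)\<close>. The sum of the two weights dominates the
      larger one.\<close>
    define m where "m = max (shell r x) (shell r y)"
    have "nrm (x - y) \<le> C * norm (x - y)"
      by (rule C(2))
    also have "\<dots> \<le> C * (norm x + norm y)"
      using C(1) by (intro mult_left_mono norm_triangle_ineq4) auto
    also have "\<dots> \<le> C * (2 ^ m * r + 2 ^ m * r)"
    proof (intro mult_left_mono add_mono)
      show "norm x \<le> 2 ^ m * r" "norm y \<le> 2 ^ m * r"
        using r by (auto simp: m_def intro!: order_trans[OF norm_le_shell[OF r]] mult_right_mono power_increasing)
    qed (use C in auto)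
    also have "\<dots> = C * 1 * (2 ^ m * r) * 2"
      by simp
    also have "\<dots> \<le> C * CARD('n) * (2 ^ m * r) * 2"
    proof -
      have "1 \<le> real CARD('n)" by simp
      then show ?thesis
        using C(1) r by (intro mult_right_mono mult_left_mono) auto
    qed
    also have "\<dots> = C * CARD('n) * (2 ^ m * r) * 2 ^ Suc k / 2 ^ L"
      by (simp add: k)
    finally have "c (x, y) \<le> ennreal (D (Suc k) m)"
      unfolding c_def D_def using p nn by (auto intro!: ennreal_leI powr_mono2)
    also have "\<dots> \<le> ennreal (D (Suc k) (shell r x)) + ennreal (D (Suc k) (shell r y))"
      unfolding m_def max_def by (auto simp: add_increasing add_increasing2)
    finally show ?thesis
      by (simp add: W_def g_def k)
  qed
  have "(\<integral>\<^sup>+ X. ennreal_powr (wasserstein nrm p \<mu> (empirical_measure N X)) p \<partial>sample) \<le>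
    (\<integral>\<^sup>+ X. (\<integral>\<^sup>+ x. w x \<partial>\<mu>) + (\<integral>\<^sup>+ x. w x \<partial>empirical_measure N X) +
      (\<Sum>k<Suc L. \<integral>\<^sup>+ i. W k i * dev k i X \<partial>count_space UNIV) \<partial>sample)"
  proof (rule nn_integral_mono)
    fix X :: "nat \<Rightarrow> real ^ 'n"
    interpret E: prob_space "empirical_measure N X"
      by (rule prob_space_empirical_measure[OF N_pos])
    interpret pair: borel_prob_pair \<mu> "empirical_measure N X"
      by unfold_locales (auto simp: sets_\<mu>)
    obtain \<xi> where \<xi>: "\<xi> \<in> couplings \<mu> (empirical_measure N X)"
      "(\<integral>\<^sup>+ z. c z \<partial>\<xi>) \<le> (\<integral>\<^sup>+ x. w x \<partial>\<mu>) + (\<integral>\<^sup>+ x. w x \<partial>empirical_measure N X) +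
        (\<Sum>k<Suc L. \<integral>\<^sup>+ i. W k i * dev k i X \<partial>count_space UNIV)"
      unfolding dev_def
      by (rule pair.coupling_by_nested_partitions[where g=g and K="Suc L" and c=c and w=w and W=W,
            OF g nested trivial cm wm c0 cW])
    have "ennreal_powr (wasserstein nrm p \<mu> (empirical_measure N X)) p \<le> (\<integral>\<^sup>+ z. c z \<partial>\<xi>)"
      unfolding c_def by (rule wasserstein_powr_le[OF \<xi>(1) p])
    also note \<xi>(2)
    finally show "ennreal_powr (wasserstein nrm p \<mu> (empirical_measure N X)) p \<le>
      (\<integral>\<^sup>+ x. w x \<partial>\<mu>) + (\<integral>\<^sup>+ x. w x \<partial>empirical_measure N X) +
        (\<Sum>k<Suc L. \<integral>\<^sup>+ i. W k i * dev k i X \<partial>count_space UNIV)" .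
  qed
  also have "\<dots> = (\<integral>\<^sup>+ x. w x \<partial>\<mu>) + (\<integral>\<^sup>+ x. w x \<partial>\<mu>) +
      (\<Sum>k\<le>L. \<integral>\<^sup>+ i. W k i * (\<integral>\<^sup>+ X. dev k i X \<partial>sample) \<partial>count_space UNIV)"
  proof -
    have dev[measurable]: "dev k i \<in> borel_measurable sample" for k i
      unfolding dev_def[abs_def] by measurable
    have m1[measurable]: "(\<lambda>X. \<integral>\<^sup>+ i. W k i * dev k i X \<partial>count_space UNIV) \<in> borel_measurable sample" for k
      by (rule borel_measurable_nn_integral_count_space) measurable
    have m2: "(\<lambda>X. \<integral>\<^sup>+ x. w x \<partial>empirical_measure N X) \<in> borel_measurable sample"
      by measurable
    \<comment> \<open>Tonelli exchanges the sum over cells with the expectation over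
      samples.\<close>
    have "(\<integral>\<^sup>+ X. (\<integral>\<^sup>+ i. W k i * dev k i X \<partial>count_space UNIV) \<partial>sample) =
        (\<integral>\<^sup>+ i. W k i * (\<integral>\<^sup>+ X. dev k i X \<partial>sample) \<partial>count_space UNIV)" for k
    proof -
      have "(\<integral>\<^sup>+ X. (\<integral>\<^sup>+ i. W k i * dev k i X \<partial>count_space UNIV) \<partial>sample) =
          (\<integral>\<^sup>+ i. (\<integral>\<^sup>+ X. W k i * dev k i X \<partial>sample) \<partial>count_space UNIV)"
        by (rule nn_integral_count_space_nn_integral) (simp, measurable)
      also have "\<dots> = (\<integral>\<^sup>+ i. W k i * (\<integral>\<^sup>+ X. dev k i X \<partial>sample) \<partial>count_space UNIV)"
        by (intro nn_integral_cong nn_integral_cmult dev)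
      finally show ?thesis .
    qed
    then show ?thesis
      using m2 expectation_nn_integral_empirical[of w] P.emeasure_space_1
      by (simp add: nn_integral_add nn_integral_sum lessThan_Suc_atMost del: One_nat_def)
  qed
  also have "\<dots> \<le> 2 * (\<integral>\<^sup>+ n. ennreal (D 0 n * \<epsilon> n) \<partial>count_space UNIV) +
    (\<Sum>k\<le>L. \<integral>\<^sup>+ n. ennreal (D (Suc k) n *
       min (2 * \<epsilon> n) (sqrt ((3 * 2 ^ (L - k)) ^ CARD('n) * \<epsilon> n / N))) \<partial>count_space UNIV)"
  proof (intro add_mono sum_mono)
    have D0: "D k n \<ge> 0" for k n
      by (simp add: D_def)
    have "(\<integral>\<^sup>+ x. w x \<partial>\<mu>) \<le> (\<integral>\<^sup>+ n. ennreal (D 0 n * \<epsilon> n) \<partial>count_space UNIV)"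
      unfolding w_def ennreal_mult'[OF D0]
      by (rule nn_integral_shell_le[OF prob_space_axioms sets_\<mu> \<epsilon>])
    then show "(\<integral>\<^sup>+ x. w x \<partial>\<mu>) + (\<integral>\<^sup>+ x. w x \<partial>\<mu>) \<le> 2 * (\<integral>\<^sup>+ n. ennreal (D 0 n * \<epsilon> n) \<partial>count_space UNIV)"
      unfolding mult_2 by (intro add_mono)
    fix k assume "k \<in> {..L}"
    then show "(\<integral>\<^sup>+ i. W k i * (\<integral>\<^sup>+ X. dev k i X \<partial>sample) \<partial>count_space UNIV) \<le>
      (\<integral>\<^sup>+ n. ennreal (D (Suc k) n * min (2 * \<epsilon> n) (sqrt ((3 * 2 ^ (L - k)) ^ CARD('n) * \<epsilon> n / N))) \<partial>count_space UNIV)"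
      using level_deviation[OF assms(1) r \<epsilon>, of "\<lambda>n. ennreal (D (Suc k) n)" "L - k"]
      unfolding ennreal_mult'[OF D0] W_def dev_def by (simp add: g_def)
  qed
  finally show ?thesis .
qed

section \<open>Decay rates and geometric series\<close>

text \<open>A minimum is at most every weighted geometric mean of its arguments; here the weights
  are \<open>1 - 2 * s\<close> and \<open>2 * s\<close>. The constant
  \<open>2 powr (1 - 2 * s)\<close> is at most 2.\<close>

lemma min_le_interpolation:
  fixes a K M s :: real
  assumes "a \<ge> 0" "K \<ge> 0" "M > 0" "0 \<le> s" "s \<le> 1 / 2"
  shows "min (2 * a) (sqrt (K * a / M)) \<le> 2 * (a powr (1 - s) * (K / M) powr s)"
proof (cases "a = 0 \<or> K = 0")
  case True
  then have "min (2 * a) (sqrt (K * a / M)) \<le> 0"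
    by auto
  then show ?thesis
    by (rule order_trans) simp
next
  case False
  then have aK: "a > 0" "K > 0"
    using assms by auto
  define u v where "u = 2 * a" and "v = sqrt (K * a / M)"
  have uv: "u > 0" "v > 0"
    using aK assms by (auto simp: u_def v_def)
  have "min u v = min u v powr (1 - 2 * s) * min u v powr (2 * s)"
    using uv by (simp flip: powr_add)
  also have "\<dots> \<le> u powr (1 - 2 * s) * v powr (2 * s)"
    using uv assms by (intro mult_mono powr_mono2) auto
  also have "v powr (2 * s) = (K / M * a) powr s"
    using aK assms by (simp add: v_def powr_half_sqrt[symmetric] powr_powr)
  also have "\<dots> = (K / M) powr s * a powr s"
    by (rule powr_mult)
  also have "u powr (1 - 2 * s) = 2 powr (1 - 2 * s) * a powr (1 - 2 * s)"
    using aK by (simp add: u_def powr_mult)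
  also have "2 powr (1 - 2 * s) * a powr (1 - 2 * s) * ((K / M) powr s * a powr s) =
      2 powr (1 - 2 * s) * (a powr (1 - s) * (K / M) powr s)"
    by (simp flip: powr_add)
  also have "\<dots> \<le> 2 * (a powr (1 - s) * (K / M) powr s)"
    using powr_mono[of "1 - 2 * s" 1 2] assms by (intro mult_right_mono) auto
  finally show ?thesis
    by (simp add: u_def v_def)
qed

lemma nn_integral_count_space_geometric:
  fixes c \<rho> :: real
  assumes "c \<ge> 0" "0 \<le> \<rho>" "\<rho> < 1"
  shows "(\<integral>\<^sup>+ n. ennreal (c * \<rho> ^ n) \<partial>count_space UNIV) = ennreal (c / (1 - \<rho>))"
proof -
  have "(\<lambda>n. c * \<rho> ^ n) sums (c * (1 / (1 - \<rho>)))"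
    using assms by (intro sums_mult geometric_sums) auto
  then show ?thesis
    using assms by (simp add: nn_integral_count_space_nat suminf_ennreal_eq sums_iff)
qed

text \<open>Depth of the finest level: its relative mesh \<open>1 / 2 ^ L\<close> is within a factor
  2 of the rate sought.\<close>

lemma dyadic_scale:
  assumes "d > 0" "N \<ge> 1"
  obtains L :: nat where "2 ^ L \<le> real N powr (1 / d)" "real N powr (1 / d) < 2 * 2 ^ L"
proof -
  have "(2 ^ nat \<lfloor>log 2 (real N powr (1 / d))\<rfloor> :: real) \<le> real N powr (1 / d) \<and>
    real N powr (1 / d) < 2 * 2 ^ nat \<lfloor>log 2 (real N powr (1 / d))\<rfloor>"
  proof -
    define t where "t = real N powr (1 / d)"
    define l where "l = \<lfloor>log 2 t\<rfloor>"
    have t: "t \<ge> 1"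
      unfolding t_def using assms by (intro ge_one_powr_ge_zero) auto
    then have "l \<ge> 0"
      by (simp add: l_def)
    have "2 powr l \<le> t"
      using t powr_mono[of "real_of_int l" "log 2 t" 2] by (simp add: l_def)
    moreover have "t < 2 powr (l + 1)"
      using t powr_less_mono[of "log 2 t" "real_of_int l + 1" 2] by (simp add: l_def)
    ultimately show ?thesis
      using \<open>l \<ge> 0\<close> unfolding t_def[symmetric] l_def[symmetric]
      by (simp add: powr_add powr_real_of_int mult.commute)
  qed
  then show ?thesis
    using that by blast
qed

text \<open>Three geometric series are summed: over the shells at the finest level, with ratio
  \<open>2 powr (p - q)\<close>; over the shells at each level, with ratio
  \<open>2 powr (p - q * (1 - s))\<close>; and over the levels, with ratio
  \<open>2 powr (p - d * s)\<close>. The conditions on \<open>s\<close> make all ratios less than 1,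
  and the limits supply the denominators of \<open>\<kappa>\<close>.\<close>

lemma expected_cost_rate:
  fixes p q s d r C :: real and N L :: nat
  assumes p: "p > 0" and d: "d > 0" and s: "p / d < s" "s \<le> 1 / 2" "p < q * (1 - s)"
    and N: "N \<ge> 1" and C: "C > 0"
    and L: "2 ^ L \<le> real N powr (1 / d)" "real N powr (1 / d) < 2 * 2 ^ L"
  defines "D \<equiv> \<lambda>k (n::nat). (C * 2 ^ n * 2 ^ k / 2 ^ L) powr p"
    and "\<epsilon> \<equiv> \<lambda>n::nat. 2 powr q * 2 powr (- q * n)"
    and "\<kappa> \<equiv> 2 * 2 powr p * 2 powr q / (1 - 2 powr (p - q)) +
      2 * 2 powr p * 2 powr (q * (1 - s)) * 3 powr (d * s) /
        ((1 - 2 powr (p - q * (1 - s))) * (1 - 2 powr (p - d * s)))"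
  shows "2 * (\<integral>\<^sup>+ n. ennreal (D 0 n * \<epsilon> n) \<partial>count_space UNIV) +
    (\<Sum>k\<le>L. \<integral>\<^sup>+ n. ennreal (D (Suc k) n *
       min (2 * \<epsilon> n) (sqrt ((3 * 2 ^ (L - k)) powr d * \<epsilon> n / N))) \<partial>count_space UNIV)
    \<le> ennreal (\<kappa> * C powr p * real N powr (- (p / d)))"
proof -
  have s0: "s > 0"
    using s p d by (meson divide_pos_pos less_trans)
  have pds: "p < d * s"
    using s d by (simp add: field_simps)
  have "q * (1 - s) > 0"
    using s p by linarith
  then have q: "q > 0"
    using s by (simp add: zero_less_mult_iff)
  then have "q * (1 - s) \<le> q * 1"
    using s0 by (intro mult_left_mono) auto
  then have pq: "p < q"
    using s by linarith
  define \<rho> where "\<rho> = (2::real) powr (p - q)"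
  define \<rho>' where "\<rho>' = (2::real) powr (p - q * (1 - s))"
  define \<rho>'' where "\<rho>'' = (2::real) powr (p - d * s)"
  have powr_lt1: "(2::real) powr x < 1" if "x < 0" for x
    using powr_less_mono[OF that, of 2] by simp
  have rho: "0 < \<rho>" "\<rho> < 1" "0 < \<rho>'" "\<rho>' < 1" "0 < \<rho>''" "\<rho>'' < 1"
    using pq s pds by (auto simp: \<rho>_def \<rho>'_def \<rho>''_def intro!: powr_lt1)
  have pow2: "(2::real) ^ n = 2 powr n" for n :: nat
    by (simp add: powr_realpow)
  have D: "D k n = C powr p * 2 powr (p * n) * 2 powr (p * k) * 2 powr (- p * L)" for k n
  proof -
    have "D k n = (C * 2 powr n * 2 powr k * 2 powr (- real L)) powr p"
      by (simp add: D_def pow2 powr_minus divide_inverse)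
    then show ?thesis
      using C by (simp add: powr_mult powr_powr mult.commute)
  qed

  have "(\<integral>\<^sup>+ n. ennreal (D 0 n * \<epsilon> n) \<partial>count_space UNIV) =
      (\<integral>\<^sup>+ n. ennreal (C powr p * 2 powr (- p * L) * 2 powr q * \<rho> ^ n) \<partial>count_space UNIV)"
  proof (intro nn_integral_cong arg_cong[where f=ennreal])
    fix n :: nat
    have "\<rho> ^ n = 2 powr (p * n) * 2 powr (- q * n)"
      using rho by (simp add: \<rho>_def powr_powr algebra_simps flip: powr_realpow powr_add)
    then show "D 0 n * \<epsilon> n = C powr p * 2 powr (- p * L) * 2 powr q * \<rho> ^ n"
      by (simp add: D \<epsilon>_def)
  qed
  also have "\<dots> = ennreal (C powr p * 2 powr (- p * L) * 2 powr q / (1 - \<rho>))"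
    using rho by (intro nn_integral_count_space_geometric) auto
  also have "\<dots> \<le> ennreal (C powr p * (2 powr p * real N powr (- (p / d))) * 2 powr q / (1 - \<rho>))"
  proof (intro ennreal_leI divide_right_mono mult_right_mono mult_left_mono)
    \<comment> \<open>Here \<open>N powr (1 / d) < 2 * 2 ^ L\<close> enters: the finest mesh is
      small enough.\<close>
    have "real N powr (p / d) = (real N powr (1 / d)) powr p"
      by (simp add: powr_powr)
    also have "\<dots> \<le> (2 * 2 ^ L) powr p"
      using L p by (intro powr_mono2) auto
    also have "\<dots> = 2 powr p * 2 powr (p * L)"
      unfolding pow2 by (simp add: powr_mult powr_powr mult.commute)
    finally show "2 powr (- p * L) \<le> 2 powr p * real N powr (- (p / d))"
      using N by (simp add: powr_minus field_simps)
  qed (use rho in auto)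
  finally have 1: "2 * (\<integral>\<^sup>+ n. ennreal (D 0 n * \<epsilon> n) \<partial>count_space UNIV) \<le>
      ennreal (2 * (C powr p * (2 powr p * real N powr (- (p / d))) * 2 powr q / (1 - \<rho>)))"
    by (subst ennreal_mult') (auto intro: mult_left_mono)
  \<comment> \<open>\<open>A\<close> collects the factors independent of \<open>k\<close> and
    \<open>L\<close>; its denominator comes from the sum over the shells.\<close>
  define A where "A = C powr p * 2 powr p * 2 * 2 powr (q * (1 - s)) * 3 powr (d * s) * real N powr (- s) / (1 - \<rho>')"
  have A: "A \<ge> 0"
    unfolding A_def using rho by auto
  have level: "(\<integral>\<^sup>+ n. ennreal (D (Suc k) n *
       min (2 * \<epsilon> n) (sqrt ((3 * 2 ^ (L - k)) powr d * \<epsilon> n / N))) \<partial>count_space UNIV) \<le>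
      ennreal (A * 2 powr ((d * s - p) * L) * \<rho>'' ^ k)" if k: "k \<le> L" for k
  proof -
    define B where "B = C powr p * 2 powr (p * Suc k) * 2 powr (- p * L) *
      (2 * (2 powr (q * (1 - s)) * (3 powr (d * s) * 2 powr (d * s * (L - k)) * real N powr (- s))))"
    have "(\<integral>\<^sup>+ n. ennreal (D (Suc k) n *
        min (2 * \<epsilon> n) (sqrt ((3 * 2 ^ (L - k)) powr d * \<epsilon> n / N))) \<partial>count_space UNIV) \<le>
      (\<integral>\<^sup>+ n. ennreal (B * \<rho>' ^ n) \<partial>count_space UNIV)"
    proof (intro nn_integral_mono ennreal_leI)
      fix n :: nat
      have "min (2 * \<epsilon> n) (sqrt ((3 * 2 ^ (L - k)) powr d * \<epsilon> n / N)) \<le>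
          2 * (\<epsilon> n powr (1 - s) * ((3 * 2 ^ (L - k)) powr d / N) powr s)"
        using N s s0 by (intro min_le_interpolation) (auto simp: \<epsilon>_def)
      also have "\<epsilon> n powr (1 - s) = 2 powr (q * (1 - s)) * 2 powr (- (q * (1 - s)) * n)"
        by (simp add: \<epsilon>_def powr_mult powr_powr mult_ac)
      also have "((3 * 2 ^ (L - k)) powr d / N) powr s =
          3 powr (d * s) * 2 powr (d * s * (L - k)) * real N powr (- s)"
        unfolding pow2 by (simp add: powr_mult powr_divide powr_powr powr_minus_divide mult_ac)
      finally have "D (Suc k) n * min (2 * \<epsilon> n) (sqrt ((3 * 2 ^ (L - k)) powr d * \<epsilon> n / N)) \<le>
          D (Suc k) n * (2 * (2 powr (q * (1 - s)) * 2 powr (- (q * (1 - s)) * n) *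
            (3 powr (d * s) * 2 powr (d * s * (L - k)) * real N powr (- s))))"
        by (intro mult_left_mono) (auto simp: D_def)
      also have "\<dots> = B * (2 powr (p * n) * 2 powr (- (q * (1 - s)) * n))"
        unfolding D B_def by simp
      also have "2 powr (p * n) * 2 powr (- (q * (1 - s)) * n) = \<rho>' ^ n"
        using rho by (simp add: \<rho>'_def powr_powr algebra_simps flip: powr_realpow powr_add)
      finally show "D (Suc k) n * min (2 * \<epsilon> n) (sqrt ((3 * 2 ^ (L - k)) powr d * \<epsilon> n / N)) \<le> B * \<rho>' ^ n" .
    qed
    also have "\<dots> = ennreal (B / (1 - \<rho>'))"
      using rho by (intro nn_integral_count_space_geometric) (auto simp: B_def)
    also have "B / (1 - \<rho>') = A * (2 powr (p * k) * 2 powr (- p * L) * 2 powr (d * s * (L - k)))"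
      by (simp add: A_def B_def powr_add algebra_simps)
    \<comment> \<open>The total exponent is \<open>(d * s - p) * (L - k)\<close>: as
      \<open>p < d * s\<close>, the contributions decrease geometrically from the finest level
      upwards.\<close>
    also have "2 powr (p * k) * 2 powr (- p * L) * 2 powr (d * s * (L - k)) =
        2 powr ((d * s - p) * L) * \<rho>'' ^ k"
      using k rho by (simp add: \<rho>''_def powr_powr of_nat_diff algebra_simps flip: powr_realpow powr_add)
    finally show ?thesis
      by (simp add: mult.assoc)
  qed
  have "(\<Sum>k\<le>L. \<integral>\<^sup>+ n. ennreal (D (Suc k) n *
       min (2 * \<epsilon> n) (sqrt ((3 * 2 ^ (L - k)) powr d * \<epsilon> n / N))) \<partial>count_space UNIV) \<le>
      (\<Sum>k\<le>L. ennreal (A * 2 powr ((d * s - p) * L) * \<rho>'' ^ k))"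
    by (intro sum_mono level) simp
  also have "\<dots> = ennreal (A * 2 powr ((d * s - p) * L) * (\<Sum>k\<le>L. \<rho>'' ^ k))"
    using A rho by (subst sum_ennreal) (auto simp: sum_distrib_left)
  also have "\<dots> \<le> ennreal (A * real N powr (s - p / d) * (1 / (1 - \<rho>'')))"
  proof (intro ennreal_leI mult_mono)
    have "(\<Sum>k\<le>L. \<rho>'' ^ k) \<le> (\<Sum>k. \<rho>'' ^ k)"
      using rho by (intro sum_le_suminf summable_geometric) auto
    then show "(\<Sum>k\<le>L. \<rho>'' ^ k) \<le> 1 / (1 - \<rho>'')"
      using rho by (simp add: suminf_geometric)
    \<comment> \<open>Here the opposite inequality \<open>2 ^ L \<le> N powr (1 / d)\<close> enters,
      with the positive exponent \<open>d * s - p\<close>.\<close>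
    have "2 powr ((d * s - p) * L) = (2 ^ L) powr (d * s - p)"
      unfolding pow2 by (simp add: powr_powr mult.commute)
    also have "\<dots> \<le> (real N powr (1 / d)) powr (d * s - p)"
      using L pds by (intro powr_mono2) auto
    also have "\<dots> = real N powr (s - p / d)"
      using d by (simp add: powr_powr diff_divide_distrib)
    finally show "2 powr ((d * s - p) * L) \<le> real N powr (s - p / d)" .
  qed (use A rho in \<open>auto intro!: sum_nonneg\<close>)
  finally have 2: "(\<Sum>k\<le>L. \<integral>\<^sup>+ n. ennreal (D (Suc k) n *
       min (2 * \<epsilon> n) (sqrt ((3 * 2 ^ (L - k)) powr d * \<epsilon> n / N))) \<partial>count_space UNIV) \<le>
      ennreal (A * real N powr (s - p / d) * (1 / (1 - \<rho>'')))" .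
  \<comment> \<open>The exponent \<open>s\<close> cancels, so all levels together give the same rate
    as the finest one.\<close>
  have NN: "real N powr (- s) * real N powr (s - p / d) = real N powr (- (p / d))"
    by (simp flip: powr_add)
  have "A * real N powr (s - p / d) * (1 / (1 - \<rho>'')) =
      C powr p * 2 powr p * 2 * 2 powr (q * (1 - s)) * 3 powr (d * s) *
        (real N powr (- s) * real N powr (s - p / d)) / ((1 - \<rho>') * (1 - \<rho>''))"
    by (simp add: A_def)
  also have "\<dots> = C powr p * 2 powr p * 2 * 2 powr (q * (1 - s)) * 3 powr (d * s) *
        real N powr (- (p / d)) / ((1 - \<rho>') * (1 - \<rho>''))"
    unfolding NN ..
  finally have "2 * (C powr p * (2 powr p * real N powr (- (p / d))) * 2 powr q / (1 - \<rho>)) +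
      A * real N powr (s - p / d) * (1 / (1 - \<rho>'')) = \<kappa> * C powr p * real N powr (- (p / d))"
    unfolding \<kappa>_def \<rho>_def[symmetric] \<rho>'_def[symmetric] \<rho>''_def[symmetric]
    by (simp add: distrib_left mult_ac)
  then show ?thesis
    using add_mono[OF 1 2] A rho by (subst (asm) ennreal_plus[symmetric]) auto
qed


section \<open>From the expected cost to the quantization error\<close>

text \<open>A Euclidean moment bound \<open>r powr q\<close> makes the shell masses decay like
  \<open>2 powr (- q * n)\<close> uniformly in \<mu>, so everything reduces to choosing
  \<open>s\<close>. The hypothesis on \<open>q\<close> amounts to \<open>p / d < 1 - p / q\<close>,
  which leaves room for it.\<close>

lemma rand_quantization_error_le_radius:
  fixes nrm :: "real ^ 'n \<Rightarrow> real" and p q :: real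
  assumes nrm: "is_norm nrm" and p: "1 \<le> p" "p < real CARD('n) / 2"
    and q: "q > real CARD('n) * p / (real CARD('n) - p)"
  shows "\<exists>\<kappa>::real. \<kappa> > 0 \<and>
    (\<forall>\<mu> N r. prob_space \<mu> \<longrightarrow> sets \<mu> = sets borel \<longrightarrow> N \<ge> 1 \<longrightarrow> r > 0 \<longrightarrow>
      (\<integral>\<^sup>+ x. ennreal (norm x powr q) \<partial>\<mu>) \<le> ennreal (r powr q) \<longrightarrow>
      rand_quantization_error nrm p N \<mu> \<le> ennreal (\<kappa> * r * real N powr (- 1 / real CARD('n))))"
proof -
  define d where "d = real CARD('n)"
  have d: "d > 0" "p < d / 2" "q > d * p / (d - p)"
    using p q by (auto simp: d_def)
  have dp: "d - p > 0"
    using d p by linarith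
  then have "q > 0"
    using d p by (intro less_trans[OF _ d(3)]) auto
  have "d * p < q * (d - p)"
    using d(3) dp by (simp add: field_simps)
  then have gap: "p / d < 1 - p / q"
    using d \<open>q > 0\<close> by (simp add: field_simps)
  \<comment> \<open>The midpoint of \<open>p / d\<close> and \<open>1 - p / q\<close>, capped at
    \<open>1 / 2\<close> for the interpolation; the cap stays above \<open>p / d\<close> because
    \<open>p < d / 2\<close>.\<close>
  define s where "s = min (1 / 2) ((p / d + (1 - p / q)) / 2)"
  have "u < min (1 / 2) ((u + v) / 2)" if "u < v" "u < 1 / 2" for u v :: real
    using that by simp
  moreover have "p / d < 1 / 2"
    using d by (simp add: field_simps)
  ultimately have "p / d < s"
    using gap unfolding s_def by blast
  moreover have "s \<le> 1 / 2"
    unfolding s_def by linarith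
  ultimately have s: "p / d < s" "s \<le> 1 / 2" .
  have "min (1 / 2) ((u + v) / 2) < v" if "u < v" for u v :: real
    using that by (simp add: min_less_iff_disj)
  then have "s < 1 - p / q"
    using gap unfolding s_def by blast
  then have s3: "p < q * (1 - s)"
    using \<open>q > 0\<close> by (simp add: field_simps)
  obtain C where C: "C > 0" "\<And>x. nrm x \<le> C * norm x"
    using is_norm_le_norm[OF nrm] by blast
  define \<kappa> where "\<kappa> = 2 * 2 powr p * 2 powr q / (1 - 2 powr (p - q)) +
      2 * 2 powr p * 2 powr (q * (1 - s)) * 3 powr (d * s) /
        ((1 - 2 powr (p - q * (1 - s))) * (1 - 2 powr (p - d * s)))"
  \<comment> \<open>The absolute value and the summand 1 make \<open>K > 0\<close> evident; the
    exponent \<open>1 / p\<close> undoes the \<open>p\<close>th power of the cost.\<close>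
  define K where "K = \<bar>\<kappa>\<bar> powr (1 / p) * (C * d) + 1"
  have "K > 0"
    unfolding K_def using C d by (intro add_nonneg_pos) auto
  moreover have "rand_quantization_error nrm p N \<mu> \<le> ennreal (K * r * real N powr (- 1 / d))"
    if \<mu>: "prob_space \<mu>" "sets \<mu> = sets borel" and N: "N \<ge> 1" and r: "r > 0"
      and moment: "(\<integral>\<^sup>+ x. ennreal (norm x powr q) \<partial>\<mu>) \<le> ennreal (r powr q)"
    for \<mu> :: "(real ^ 'n) measure" and N :: nat and r :: real
  proof -
    have iid: "iid_sample \<mu> N"
      using \<mu> N by (simp add: iid_sample_def iid_sample_axioms_def)
    obtain L :: nat where L: "2 ^ L \<le> real N powr (1 / d)" "real N powr (1 / d) < 2 * 2 ^ L"
      using dyadic_scale[OF d(1) N] by blast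
    \<comment> \<open>Rewrites the weights so that \<open>C * d * r\<close> takes the place of the
      constant \<open>C\<close> in \<open>expected_cost_rate\<close>.\<close>
    have base: "C * d * (2 ^ n * r) * 2 ^ k / 2 ^ L = C * d * r * 2 ^ n * 2 ^ k / 2 ^ L" for n k :: nat
      by simp
    have power_d: "(3 * 2 ^ (L - k)) ^ CARD('n) = ((3 * 2 ^ (L - k)) powr d :: real)" for k
      by (simp add: d_def powr_realpow)
    have "(\<integral>\<^sup>+ X. ennreal_powr (wasserstein nrm p \<mu> (empirical_measure N X)) p \<partial>(\<Pi>\<^sub>M j\<in>{1..N}. \<mu>)) \<le>
        ennreal (\<kappa> * (C * d * r) powr p * real N powr (- (p / d)))"
      using order_trans[OF
          expected_cost[OF iid r _ nrm C shell_mass[OF \<mu> r \<open>q > 0\<close> moment], of p L,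
            folded d_def, unfolded base power_d]
          expected_cost_rate[OF _ d(1) s s3 N _ L, of "C * d * r", folded \<kappa>_def]]
        p C d r by simp
    also have "\<dots> \<le> ennreal (\<bar>\<kappa>\<bar> * (C * d * r) powr p * real N powr (- (p / d)))"
      by (intro ennreal_leI mult_right_mono) auto
    finally have "rand_quantization_error nrm p N \<mu> \<le>
        ennreal_powr (ennreal (\<bar>\<kappa>\<bar> * (C * d * r) powr p * real N powr (- (p / d)))) (1 / p)"
      unfolding rand_quantization_error_def using p by (intro ennreal_powr_mono) auto
    also have "\<dots> = ennreal ((\<bar>\<kappa>\<bar> * (C * d * r) powr p * real N powr (- (p / d))) powr (1 / p))"
      by (simp add: ennreal_powr_def)
    also have "(\<bar>\<kappa>\<bar> * (C * d * r) powr p * real N powr (- (p / d))) powr (1 / p) =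
        \<bar>\<kappa>\<bar> powr (1 / p) * (C * d * r) * real N powr (- 1 / d)"
      using p C d r by (simp add: powr_mult powr_powr)
    also have "\<dots> \<le> K * r * real N powr (- 1 / d)"
      unfolding K_def using r by (intro mult_right_mono) (auto simp: algebra_simps)
    finally show ?thesis
      by (simp add: ennreal_leI)
  qed
  ultimately show ?thesis
    unfolding d_def by blast
qed

section \<open>Moments in an arbitrary norm\<close>

theorem theorem1:
  fixes nrm :: "real ^ 'n \<Rightarrow> real" and p q :: real
  assumes "CARD('n) \<ge> 3"
    and "is_norm nrm"
    and "1 \<le> p" and "p < real CARD('n) / 2"
    and "q > real CARD('n) * p / (real CARD('n) - p)"
  shows "\<exists>\<kappa>::real. \<kappa> > 0 \<and>
    (\<forall>\<mu> :: (real ^ 'n) measure. prob_space \<mu> \<longrightarrow> sets \<mu> = sets borel \<longrightarrow>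
      (\<forall>N::nat. N \<ge> 1 \<longrightarrow>
        rand_quantization_error nrm p N \<mu> \<le>
          ennreal \<kappa> * ennreal_powr (\<integral>\<^sup>+ x. ennreal (nrm x powr q) \<partial>\<mu>) (1 / q)
            * ennreal (real N powr (- 1 / real CARD('n)))))"
proof -
  have "q > 0"
    using assms(3-) by (intro less_trans[OF _ assms(5)]) auto
  obtain \<kappa> where \<kappa>: "\<kappa> > 0" and error:
    "\<And>\<mu> N r. prob_space \<mu> \<Longrightarrow> sets \<mu> = sets borel \<Longrightarrow> N \<ge> 1 \<Longrightarrow> r > 0 \<Longrightarrow>
      (\<integral>\<^sup>+ x. ennreal (norm x powr q) \<partial>\<mu>) \<le> ennreal (r powr q) \<Longrightarrow>
      rand_quantization_error nrm p N \<mu> \<le> ennreal (\<kappa> * r * real N powr (- 1 / real CARD('n)))"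
    using rand_quantization_error_le_radius[OF assms(2-)] by blast
  obtain C where C: "C > 0" "\<And>x. norm x \<le> C * nrm x"
    using is_norm_ge_norm[OF assms(2)] by blast
  have nn: "nrm x \<ge> 0" for x
    using assms(2) by (auto simp: is_norm_def)
  have [measurable]: "nrm \<in> borel_measurable borel"
    by (intro borel_measurable_continuous_onI is_norm_continuous_on assms(2))
  have "rand_quantization_error nrm p N \<mu> \<le>
      ennreal (\<kappa> * C) * ennreal_powr (\<integral>\<^sup>+ x. ennreal (nrm x powr q) \<partial>\<mu>) (1 / q)
        * ennreal (real N powr (- 1 / real CARD('n)))"
    if \<mu>: "prob_space \<mu>" and [measurable_cong]: "sets \<mu> = sets borel" and N: "N \<ge> 1"
    for \<mu> :: "(real ^ 'n) measure" and N :: nat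
  proof (cases "\<integral>\<^sup>+ x. ennreal (nrm x powr q) \<partial>\<mu>")
    \<comment> \<open>An infinite moment makes the right-hand side infinite, since the other factors
      are positive.\<close>
    case top
    then show ?thesis
      using \<kappa> C N by (simp add: ennreal_powr_def ennreal_mult_top ennreal_top_mult)
  next
    case (real M)
    define m where "m = M powr (1 / q)"
    define t where "t = real N powr (- 1 / real CARD('n))"
    have "t > 0" "m \<ge> 0"
      using N by (auto simp: t_def m_def)
    have M: "M = m powr q"
      using real(1) \<open>q > 0\<close> by (simp add: m_def powr_powr)
    \<comment> \<open>Radii strictly above the \<open>q\<close>th moment norm \<open>m\<close> avoid a separate treatment of \<open>m = 0\<close>.\<close>
    have bound: "rand_quantization_error nrm p N \<mu> \<le> ennreal (\<kappa> * (C * r) * t)" if "r > m" for r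
      unfolding t_def
    proof (rule error)
      \<comment> \<open>Comparison of norms turns the \<open>nrm\<close>-moment into a Euclidean
        moment bound with radius \<open>C * r\<close>; this puts the factor \<open>C\<close> into
        the final constant.\<close>
      have "(\<integral>\<^sup>+ x. ennreal (norm x powr q) \<partial>\<mu>) \<le> (\<integral>\<^sup>+ x. ennreal (C powr q) * ennreal (nrm x powr q) \<partial>\<mu>)"
      proof (intro nn_integral_mono)
        fix x
        have "norm x powr q \<le> (C * nrm x) powr q"
          using C \<open>q > 0\<close> by (intro powr_mono2) auto
        then show "ennreal (norm x powr q) \<le> ennreal (C powr q) * ennreal (nrm x powr q)"
          by (simp add: powr_mult ennreal_leI flip: ennreal_mult)
      qed
      also have "\<dots> = ennreal ((C * m) powr q)"
        by (subst nn_integral_cmult) (auto simp: real M powr_mult ennreal_mult)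
      also have "\<dots> \<le> ennreal ((C * r) powr q)"
        using that C \<open>q > 0\<close> \<open>m \<ge> 0\<close> by (intro ennreal_leI powr_mono2 mult_left_mono) auto
      finally show "(\<integral>\<^sup>+ x. ennreal (norm x powr q) \<partial>\<mu>) \<le> ennreal ((C * r) powr q)" .
      show "C * r > 0"
        using C that \<open>m \<ge> 0\<close> by simp
    qed fact+
    have "rand_quantization_error nrm p N \<mu> \<le> ennreal (\<kappa> * C * m * t)"
    proof (rule ennreal_le_epsilon)
      fix e :: real assume "e > 0"
      \<comment> \<open>The radius exceeds \<open>m\<close> by exactly the amount that raises the
        bound by \<open>e\<close>; arbitrary \<open>e > 0\<close> gives the bound at
        \<open>m\<close> itself.\<close>
      then have "rand_quantization_error nrm p N \<mu> \<le> ennreal (\<kappa> * (C * (m + e / (\<kappa> * C * t))) * t)"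
        using \<kappa> C \<open>t > 0\<close> by (intro bound) simp
      also have "\<kappa> * (C * (m + e / (\<kappa> * C * t))) * t = \<kappa> * C * m * t + e"
        using \<kappa> C \<open>t > 0\<close> by (simp add: field_simps)
      also have "ennreal \<dots> = ennreal (\<kappa> * C * m * t) + ennreal e"
        using \<kappa> C \<open>t > 0\<close> \<open>m \<ge> 0\<close> \<open>e > 0\<close> by (intro ennreal_plus) auto
      finally show "rand_quantization_error nrm p N \<mu> \<le> ennreal (\<kappa> * C * m * t) + ennreal e" .
    qed
    then show ?thesis
      using \<kappa> C real \<open>m \<ge> 0\<close> \<open>t > 0\<close>
      by (simp add: ennreal_powr_def m_def t_def ennreal_mult)
  qed
  with \<kappa> C(1) show ?thesis
    by (intro exI[of _ "\<kappa> * C"]) auto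
qed

end
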